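(* Let $\mathcal{A}$ be a unital $C^*$-algebra. The assignment $\langle A\rangle_{\mathrm{M}}\mapsto \langle A\rangle_{\mathrm{C}}$ for $A\in M(\mathcal{A})$ gives a (well-defined) order-preserving homomorphism of monoids $\mathrm{W}_{\mathrm{M}}(\mathcal{A})\rightarrow \mathrm{W}_{\mathrm{C}}(\mathcal{A})$. In particular, every dimension function for $\mathcal{A}$ is a Sylvester matrix rank function for $\mathcal{A}$.
   Context: All unital rings are nonzero. For a unital ring $R$, $M(R)$ denotes the set of all rectangular (finite) matrices over $R$. Write $\mathrm{diag}(A,B)=\begin{bmatrix}A&0\\0&B\end{bmatrix}$ for (possibly rectangular) $A,B$; blank matrix entries are $0$. Matrix Malcolmson semigroup. For $A,B\in M(R)$ write $A\lesssim B$ if either $A=CBD$ for some $C,D\in M(R)$, or $B=\begin{bmatrix}C&E\\0&D\end{bmatrix}$ and $A=\begin{bmatrix}C&0\\0&D\end{bmatrix}$ for some $C,D,E\in M(R)$. Write $A\preceq_{\mathrm{M}}B$ if there are $n\ge1$ and $A_1,\dots,A_n\in M(R)$ with $A=A_1\lesssim A_2\lesssim\dots\lesssim A_n=B$. Write $A\sim_{\mathrm{M}}B$ if $A\preceq_{\mathrm{M}}B$ and $B\preceq_{\mathrm{M}}A$. Set $\mathrm{W}_{\mathrm{M}}(R)=M(R)/\sim_{\mathrm{M}}$, with $\langle A\rangle_{\mathrm{M}}$ the class of $A$. It is an abelian monoid under $\langle A\rangle_{\mathrm{M}}+\langle B\rangle_{\mathrm{M}}=\langle\mathrm{diag}(A,B)\rangle_{\mathrm{M}}$,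 with identity $\langle 0\rangle_{\mathrm{M}}$, partially ordered by $\langle A\rangle_{\mathrm{M}}\preceq_{\mathrm{M}}\langle B\rangle_{\mathrm{M}}$ iff $A\preceq_{\mathrm{M}}B$. Cuntz semigroup. For a $C^*$-algebra $\mathcal{A}$ and $A,B\in M(\mathcal{A})$ (rectangular matrices, not necessarily positive), write $A\preceq_{\mathrm{C}}B$ if there are sequences $\{C_n\},\{D_n\}$ in $M(\mathcal{A})$ with $C_nBD_n\to A$ in norm. Write $A\sim_{\mathrm{C}}B$ if $A\preceq_{\mathrm{C}}B$ and $B\preceq_{\mathrm{C}}A$. Set $\mathrm{W}_{\mathrm{C}}(\mathcal{A})=M(\mathcal{A})/\sim_{\mathrm{C}}$ with classes $\langle A\rangle_{\mathrm{C}}$, an abelian monoid under $\langle A\rangle_{\mathrm{C}}+\langle B\rangle_{\mathrm{C}}=\langle\mathrm{diag}(A,B)\rangle_{\mathrm{C}}$ with identity $\langle 0\rangle_{\mathrm{C}}$, partially ordered by $\langle A\rangle_{\mathrm{C}}\preceq_{\mathrm{C}}\langle B\rangle_{\mathrm{C}}$ iff $A\preceq_{\mathrm{C}}B$. A dimension function for a unital $C^*$-algebra $\mathcal{A}$ is a function $\varphi:M(\mathcal{A})\to\mathbb{R}_{\ge0}$ such that $\varphi(A)\le\varphi(B)$ whenever $A\preceq_{\mathrm{C}}B$, $\varphi(1)=1$, and $\varphi(\mathrm{diag}(A,B))=\varphi(A)+\varphi(B)$. A Sylvester matrix rank function for a unital ring $R$ is a function $\mathrm{rk}:M(R)\to\mathbb{R}_{\ge0}$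 such that (1) $\mathrm{rk}(0)=0$ (for every zero matrix) and $\mathrm{rk}(1)=1$; (2) $\mathrm{rk}(AB)\le\min(\mathrm{rk}(A),\mathrm{rk}(B))$ whenever $AB$ is defined; (3) $\mathrm{rk}(\mathrm{diag}(A,B))=\mathrm{rk}(A)+\mathrm{rk}(B)$; (4) $\mathrm{rk}\left(\begin{bmatrix}A&C\\0&B\end{bmatrix}\right)\ge\mathrm{rk}(A)+\mathrm{rk}(B)$. *)

theory Defs
  imports Jordan_Normal_Form.Matrix "HOL-Algebra.Group" Complex_Main
begin

text \<open>A unital C*-algebra is a complex unital Banach algebra with a conjugate-linear,
  anti-multiplicative involution satisfying the C*-identity.  The superclass
  \<open>real_normed_algebra_1\<close> contributes \<open>0 \<noteq> 1\<close>, submultiplicativity of the norm, and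
  \<open>norm 1 = 1\<close> (which the C*-identity forces anyway in a nonzero algebra).\<close>

class unital_cstar_algebra = real_normed_algebra_1 + banach +
  fixes scaleC :: "complex \<Rightarrow> 'a \<Rightarrow> 'a"
    and star :: "'a \<Rightarrow> 'a"
  assumes scaleC_add_right: "scaleC c (x + y) = scaleC c x + scaleC c y"
    and scaleC_add_left: "scaleC (c + d) x = scaleC c x + scaleC d x"
    and scaleC_scaleC: "scaleC c (scaleC d x) = scaleC (c * d) x"
    and scaleC_of_real: "scaleC (complex_of_real r) x = scaleR r x"
    and scaleC_mult_left: "scaleC c x * y = scaleC c (x * y)"
    and scaleC_mult_right: "x * scaleC c y = scaleC c (x * y)"
    and norm_scaleC: "norm (scaleC c x) = cmod c * norm x"
    and star_star: "star (star x) = x"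
    and star_add: "star (x + y) = star x + star y"
    and star_scaleC: "star (scaleC c x) = scaleC (cnj c) (star x)"
    and star_mult: "star (x * y) = star y * star x"
    and norm_star_mult: "norm (star x * x) = (norm x)\<^sup>2"

subsection \<open>Rectangular matrices\<close>

text \<open>The type \<open>'a mat\<close> also contains matrices with no rows or no columns; these are excluded
  from $M(R)$.\<close>

definition rect_mats :: "'a mat set" where
  "rect_mats = {A. 0 < dim_row A \<and> 0 < dim_col A}"

definition upper_mat :: "'a::zero mat \<Rightarrow> 'a mat \<Rightarrow> 'a mat \<Rightarrow> 'a mat" where
  "upper_mat A E B = four_block_mat A E (0\<^sub>m (dim_row B) (dim_col A)) B"

definition diag_mat2 :: "'a::zero mat \<Rightarrow> 'a mat \<Rightarrow> 'a mat" where
  "diag_mat2 A B = upper_mat A (0\<^sub>m (dim_row A) (dim_col B)) B"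

subsection \<open>The ordered monoid of classes of a preorder on matrices\<close>

definition mat_equiv :: "('a mat \<Rightarrow> 'a mat \<Rightarrow> bool) \<Rightarrow> 'a mat rel" where
  "mat_equiv leq = {(A, B). A \<in> rect_mats \<and> B \<in> rect_mats \<and> leq A B \<and> leq B A}"

definition mat_class :: "('a mat \<Rightarrow> 'a mat \<Rightarrow> bool) \<Rightarrow> 'a mat \<Rightarrow> 'a mat set" where
  "mat_class leq A = mat_equiv leq `` {A}"

text \<open>When the sum of classes does not depend on representatives, the union below is the
  single class of \<open>diag_mat2 A B\<close>.\<close>

definition mat_class_monoid :: "('a::zero mat \<Rightarrow> 'a mat \<Rightarrow> bool) \<Rightarrow> 'a mat set monoid" where
  "mat_class_monoid leq =
     \<lparr>carrier = rect_mats // mat_equiv leq,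
      mult = (\<lambda>X Y. \<Union>A\<in>X. \<Union>B\<in>Y. mat_class leq (diag_mat2 A B)),
      one = mat_class leq (0\<^sub>m 1 1)\<rparr>"

definition mat_class_order :: "('a mat \<Rightarrow> 'a mat \<Rightarrow> bool) \<Rightarrow> 'a mat set rel" where
  "mat_class_order leq =
     {(X, Y). X \<in> rect_mats // mat_equiv leq \<and> Y \<in> rect_mats // mat_equiv leq \<and>
        (\<exists>A\<in>X. \<exists>B\<in>Y. leq A B)}"

definition order_preserving_monoid_hom ::
  "('a, 'c) monoid_scheme \<Rightarrow> 'a rel \<Rightarrow> ('b, 'd) monoid_scheme \<Rightarrow> 'b rel \<Rightarrow> ('a \<Rightarrow> 'b) \<Rightarrow> bool"
where
  "order_preserving_monoid_hom G r H s h \<longleftrightarrow>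
     comm_monoid G \<and> partial_order_on (carrier G) r \<and>
     comm_monoid H \<and> partial_order_on (carrier H) s \<and>
     h \<in> hom G H \<and> h \<one>\<^bsub>G\<^esub> = \<one>\<^bsub>H\<^esub> \<and>
     (\<forall>x y. (x, y) \<in> r \<longrightarrow> (h x, h y) \<in> s)"

subsection \<open>The matrix Malcolmson semigroup\<close>

definition malcolmson_step :: "'a::ring_1 mat \<Rightarrow> 'a mat \<Rightarrow> bool" where
  "malcolmson_step A B \<longleftrightarrow> A \<in> rect_mats \<and> B \<in> rect_mats \<and>
     ((\<exists>C\<in>rect_mats. \<exists>D\<in>rect_mats.
         dim_col C = dim_row B \<and> dim_row D = dim_col B \<and> A = C * B * D) \<or>
      (\<exists>C\<in>rect_mats. \<exists>D\<in>rect_mats. \<exists>E\<in>rect_mats.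
         dim_row E = dim_row C \<and> dim_col E = dim_col D \<and>
         B = upper_mat C E D \<and> A = diag_mat2 C D))"

definition malcolmson_le :: "'a::ring_1 mat \<Rightarrow> 'a mat \<Rightarrow> bool" where
  "malcolmson_le A B \<longleftrightarrow> A \<in> rect_mats \<and> B \<in> rect_mats \<and> malcolmson_step\<^sup>*\<^sup>* A B"

definition W_M :: "'a::ring_1 mat set monoid" where
  "W_M = mat_class_monoid malcolmson_le"

definition W_M_order :: "'a::ring_1 mat set rel" where
  "W_M_order = mat_class_order malcolmson_le"

subsection \<open>The C*-norm on matrices and the Cuntz semigroup\<close>

definition star_mat :: "'a::unital_cstar_algebra mat \<Rightarrow> 'a mat" where
  "star_mat A = mat (dim_col A) (dim_row A) (\<lambda>(i, j). star (A $$ (j, i)))"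

definition mat_cstar_seminorm :: "('a::unital_cstar_algebra mat \<Rightarrow> real) \<Rightarrow> bool" where
  "mat_cstar_seminorm p \<longleftrightarrow>
     (\<forall>A\<in>rect_mats. 0 \<le> p A) \<and>
     (\<forall>A\<in>rect_mats. \<forall>B\<in>rect_mats. dim_row A = dim_row B \<longrightarrow> dim_col A = dim_col B \<longrightarrow>
        p (A + B) \<le> p A + p B) \<and>
     (\<forall>c. \<forall>A\<in>rect_mats. p (map_mat (scaleC c) A) = cmod c * p A) \<and>
     (\<forall>A\<in>rect_mats. \<forall>B\<in>rect_mats. dim_col A = dim_row B \<longrightarrow> p (A * B) \<le> p A * p B) \<and>
     (\<forall>A\<in>rect_mats. p (star_mat A * A) = (p A)\<^sup>2) \<and>
     (\<forall>a. p (mat 1 1 (\<lambda>_. a)) \<le> norm a)"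

text \<open>The C*-norm on $M_{m,n}(\mathcal A)$ is the greatest C*-seminorm: a C*-seminorm on the
  C*-algebra $M_n(\mathcal A)$ comes from a *-homomorphism into a C*-algebra, and those are
  contractive, while the C*-norm itself (given, for instance, by a faithful representation of
  $\mathcal A$) belongs to the family; for rectangular matrices use
  $\|A\|^2 = \|A^*A\|$.  By the same contractivity the bound on 1-by-1 matrices in
  \<open>mat_cstar_seminorm\<close> excludes no C*-seminorm; it makes the set below visibly bounded.
  On 1-by-1 matrices the result is the given norm of $\mathcal A$.\<close>

definition cstar_mat_norm :: "'a::unital_cstar_algebra mat \<Rightarrow> real" where
  "cstar_mat_norm A = (SUP p \<in> {p. mat_cstar_seminorm p}. p A)"

definition cuntz_le :: "'a::unital_cstar_algebra mat \<Rightarrow> 'a mat \<Rightarrow> bool" where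
  "cuntz_le A B \<longleftrightarrow> A \<in> rect_mats \<and> B \<in> rect_mats \<and>
     (\<exists>C D :: nat \<Rightarrow> 'a mat.
        (\<forall>n. C n \<in> carrier_mat (dim_row A) (dim_row B) \<and>
             D n \<in> carrier_mat (dim_col B) (dim_col A)) \<and>
        (\<lambda>n. cstar_mat_norm (C n * B * D n - A)) \<longlonglongrightarrow> 0)"

definition W_C :: "'a::unital_cstar_algebra mat set monoid" where
  "W_C = mat_class_monoid cuntz_le"

definition W_C_order :: "'a::unital_cstar_algebra mat set rel" where
  "W_C_order = mat_class_order cuntz_le"

subsection \<open>Dimension functions and Sylvester matrix rank functions\<close>

text \<open>Both kinds of functions live on \<open>rect_mats\<close>; their values elsewhere are irrelevant.\<close>

definition dimension_function :: "('a::unital_cstar_algebra mat \<Rightarrow> real) \<Rightarrow> bool" where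
  "dimension_function \<phi> \<longleftrightarrow>
     (\<forall>A\<in>rect_mats. 0 \<le> \<phi> A) \<and>
     (\<forall>A\<in>rect_mats. \<forall>B\<in>rect_mats. cuntz_le A B \<longrightarrow> \<phi> A \<le> \<phi> B) \<and>
     \<phi> (1\<^sub>m 1) = 1 \<and>
     (\<forall>A\<in>rect_mats. \<forall>B\<in>rect_mats. \<phi> (diag_mat2 A B) = \<phi> A + \<phi> B)"

definition sylvester_rank_function :: "('a::ring_1 mat \<Rightarrow> real) \<Rightarrow> bool" where
  "sylvester_rank_function rk \<longleftrightarrow>
     (\<forall>A\<in>rect_mats. 0 \<le> rk A) \<and>
     (\<forall>m>0. \<forall>n>0. rk (0\<^sub>m m n) = 0) \<and> rk (1\<^sub>m 1) = 1 \<and>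
     (\<forall>A\<in>rect_mats. \<forall>B\<in>rect_mats. dim_col A = dim_row B \<longrightarrow>
        rk (A * B) \<le> min (rk A) (rk B)) \<and>
     (\<forall>A\<in>rect_mats. \<forall>B\<in>rect_mats. rk (diag_mat2 A B) = rk A + rk B) \<and>
     (\<forall>A\<in>rect_mats. \<forall>B\<in>rect_mats. \<forall>C\<in>rect_mats.
        dim_row C = dim_row A \<longrightarrow> dim_col C = dim_col B \<longrightarrow>
        rk (upper_mat A C B) \<ge> rk A + rk B)"

end

theory Submission
  imports Defs
begin

text \<open>The only nontrivial point is that \<open>diag(C, D)\<close> is Cuntz below the block upper triangular matrix
  \<open>B\<close> with diagonal \<open>C, D\<close> and corner \<open>E\<close>.  Put \<open>h = D\<^sup>* D\<close> and let \<open>y\<close>, \<open>z\<close> be approximate inverses of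
  \<open>h + \<i>\<delta>\<^sup>2\<close> and \<open>h + \<i>\<delta>\<close>.  Subtracting \<open>E y D\<^sup>*\<close> times the second block row of \<open>B\<close> from the first
  replaces \<open>E\<close> by \<open>E (1 - y h)\<close>, which is about \<open>\<i>\<delta>\<^sup>2 E y\<close>; multiplying the second block column by
  \<open>h z\<close> then makes the corner of size \<open>O(\<delta>)\<close>, since \<open>y h\<close> is bounded and \<open>z\<close> has norm \<open>O(1/\<delta>)\<close>, while
  \<open>D h z\<close> stays within \<open>O(\<surd>\<delta>)\<close> of \<open>D\<close> by the C*-identity.  Resolvents at imaginary points exist
  because \<open>h\<close> is self-adjoint, so the positivity of \<open>D\<^sup>* D\<close> is never needed.\<close>

subsection \<open>Ordered monoids of matrix classes\<close>

lemma diag_mat2_alt: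
  "diag_mat2 A B =
     four_block_mat A (0\<^sub>m (dim_row A) (dim_col B)) (0\<^sub>m (dim_row B) (dim_col A)) B"
  by (simp add: diag_mat2_def upper_mat_def)

lemma dim_upper_mat [simp]:
  "dim_row (upper_mat A E B) = dim_row A + dim_row B"
  "dim_col (upper_mat A E B) = dim_col A + dim_col B"
  by (simp_all add: upper_mat_def)

lemma dim_diag_mat2 [simp]:
  "dim_row (diag_mat2 A B) = dim_row A + dim_row B"
  "dim_col (diag_mat2 A B) = dim_col A + dim_col B"
  by (simp_all add: diag_mat2_def)

lemma upper_mat_rect: "A \<in> rect_mats \<Longrightarrow> upper_mat A E B \<in> rect_mats"
  by (simp add: rect_mats_def)

lemma diag_mat2_rect: "A \<in> rect_mats \<Longrightarrow> diag_mat2 A B \<in> rect_mats"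
  by (simp add: rect_mats_def)

lemma diag_mat2_assoc: "diag_mat2 (diag_mat2 A B) C = diag_mat2 A (diag_mat2 B C)"
  using assoc_four_block_mat[of A B C] by (simp add: diag_mat2_alt)

text \<open>Block matrices with blocks that have no rows or no columns encode the concatenation
  of two matrices side by side or on top of each other.\<close>

lemma upper_mat_diag_mat2:
  assumes "dim_row E = dim_row C" "dim_col E = dim_col D"
  shows "diag_mat2 (upper_mat C E D) X =
    upper_mat C (four_block_mat E (0\<^sub>m (dim_row C) (dim_col X)) (0\<^sub>m 0 (dim_col E)) (0\<^sub>m 0 (dim_col X)))
      (diag_mat2 D X)"
proof (rule eq_matI, goal_cases)
  case (1 i j)
  then show ?case
    using assms
    by (cases "i < dim_row C"; cases "i < dim_row C + dim_row D";
        cases "j < dim_col C"; cases "j < dim_col C + dim_col D")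
      (simp_all add: diag_mat2_alt upper_mat_def less_diff_conv2)
qed (use assms in simp_all)

text \<open>Side conditions phrased through \<open>dim_row\<close> and \<open>dim_col\<close>,
  rather than through carrier sets, can be discharged by the simplifier, also when some blocks are
  empty.\<close>

lemma four_block_mat_mult_dims:
  fixes A1 :: "'a::semiring_0 mat"
  assumes "dim_row B1 = dim_row A1" "dim_col C1 = dim_col A1"
    "dim_row C1 = dim_row D1" "dim_col B1 = dim_col D1"
    "dim_row B2 = dim_row A2" "dim_col C2 = dim_col A2"
    "dim_row C2 = dim_row D2" "dim_col B2 = dim_col D2"
    "dim_col A1 = dim_row A2" "dim_col D1 = dim_row D2"
  shows "four_block_mat A1 B1 C1 D1 * four_block_mat A2 B2 C2 D2
    = four_block_mat (A1 * A2 + B1 * C2) (A1 * B2 + B1 * D2)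
        (C1 * A2 + D1 * C2) (C1 * B2 + D1 * D2)"
  by (rule mult_four_block_mat[of _ "dim_row A1" "dim_col A1" _ "dim_col D1" _ "dim_row D1"
        _ _ "dim_col A2" _ "dim_col D2"]) (use assms in auto)

lemma mult_zero_mat_dims [simp]:
  fixes A :: "'a::semiring_0 mat"
  shows "dim_col A = m \<Longrightarrow> A * 0\<^sub>m m n = 0\<^sub>m (dim_row A) n"
    and "n = dim_row A \<Longrightarrow> 0\<^sub>m m n * A = 0\<^sub>m m (dim_col A)"
  by (auto intro: right_mult_zero_mat left_mult_zero_mat)

lemma add_zero_mat_dims [simp]:
  fixes A :: "'a::monoid_add mat"
  shows "dim_row A = m \<Longrightarrow> dim_col A = n \<Longrightarrow> A + 0\<^sub>m m n = A"
    and "dim_row A = m \<Longrightarrow> dim_col A = n \<Longrightarrow> 0\<^sub>m m n + A = A"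
  by (auto intro: right_add_zero_mat left_add_zero_mat)

lemma diag_mat2_mult:
  fixes A :: "'a::semiring_0 mat"
  assumes "dim_col A = dim_row C" "dim_col B = dim_row D"
  shows "diag_mat2 A B * diag_mat2 C D = diag_mat2 (A * C) (B * D)"
  using assms by (simp add: diag_mat2_alt four_block_mat_mult_dims)

text \<open>\<open>P\<close> and \<open>Q\<close> are the block permutation matrices that swap the
  two row blocks and the two column blocks.\<close>

lemma diag_mat2_commute:
  fixes A B :: "'a::ring_1 mat"
  shows "\<exists>P Q. P \<in> carrier_mat (dim_row A + dim_row B) (dim_row B + dim_row A) \<and>
    Q \<in> carrier_mat (dim_col B + dim_col A) (dim_col A + dim_col B) \<and>
    diag_mat2 A B = P * diag_mat2 B A * Q"
proof -
  let ?P = "four_block_mat (0\<^sub>m (dim_row A) (dim_row B)) (1\<^sub>m (dim_row A))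
    (1\<^sub>m (dim_row B)) (0\<^sub>m (dim_row B) (dim_row A)) :: 'a mat"
  let ?Q = "four_block_mat (0\<^sub>m (dim_col B) (dim_col A)) (1\<^sub>m (dim_col B))
    (1\<^sub>m (dim_col A)) (0\<^sub>m (dim_col A) (dim_col B)) :: 'a mat"
  have "diag_mat2 A B = ?P * diag_mat2 B A * ?Q"
    by (simp add: diag_mat2_alt four_block_mat_mult_dims)
  then show ?thesis
    by (intro exI[of _ ?P] exI[of _ ?Q]) auto
qed

text \<open>The left factor puts \<open>m\<close> zero rows above \<open>A\<close>, the right factor
  \<open>n\<close> zero columns in front of it. Each is a column or a row of two blocks, padded with
  empty blocks.\<close>

lemma diag_mat2_zero_left:
  fixes A :: "'a::ring_1 mat"
  shows "diag_mat2 (0\<^sub>m m n) A =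
      four_block_mat (0\<^sub>m m (dim_row A)) (0\<^sub>m m 0) (1\<^sub>m (dim_row A)) (0\<^sub>m (dim_row A) 0) * A *
      four_block_mat (0\<^sub>m (dim_col A) n) (1\<^sub>m (dim_col A)) (0\<^sub>m 0 n) (0\<^sub>m 0 (dim_col A))"
    (is "_ = ?P * A * ?Q")
proof -
  \<comment> \<open>Padding \<open>A\<close> itself with empty blocks makes the block product
    formula applicable.\<close>
  have A: "A = four_block_mat A (0\<^sub>m (dim_row A) 0) (0\<^sub>m 0 (dim_col A)) (0\<^sub>m 0 0)"
    by (rule eq_matI) auto
  have "?P * A = ?P * four_block_mat A (0\<^sub>m (dim_row A) 0) (0\<^sub>m 0 (dim_col A)) (0\<^sub>m 0 0)"
    by (rule arg_cong[OF A])
  also have "\<dots> = four_block_mat (0\<^sub>m m (dim_col A)) (0\<^sub>m m 0) A (0\<^sub>m (dim_row A) 0)"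
    by (simp add: four_block_mat_mult_dims)
  finally have "?P * A * ?Q = four_block_mat (0\<^sub>m m (dim_col A)) (0\<^sub>m m 0) A (0\<^sub>m (dim_row A) 0) * ?Q"
    by simp
  also have "\<dots> = diag_mat2 (0\<^sub>m m n) A"
    by (simp add: four_block_mat_mult_dims diag_mat2_alt)
  finally show ?thesis ..
qed

text \<open>The transposed inclusions cut the zero rows and columns away again. Together with the
  previous lemma this makes a zero summand neutral.\<close>

lemma diag_mat2_zero_left_compress:
  fixes A :: "'a::ring_1 mat"
  shows "A = four_block_mat (0\<^sub>m (dim_row A) m) (1\<^sub>m (dim_row A)) (0\<^sub>m 0 m) (0\<^sub>m 0 (dim_row A))
      * diag_mat2 (0\<^sub>m m n) A *
      four_block_mat (0\<^sub>m n (dim_col A)) (0\<^sub>m n 0) (1\<^sub>m (dim_col A)) (0\<^sub>m (dim_col A) 0)"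
    (is "_ = ?P * _ * ?Q")
proof -
  have "?P * diag_mat2 (0\<^sub>m m n) A * ?Q = four_block_mat A (0\<^sub>m (dim_row A) 0) (0\<^sub>m 0 (dim_col A)) (0\<^sub>m 0 0)"
    by (simp add: four_block_mat_mult_dims diag_mat2_alt)
  also have "\<dots> = A"
    by (rule eq_matI) auto
  finally show ?thesis ..
qed

section \<open>The ordered commutative monoid attached to a preorder on matrices\<close>

text \<open>These properties are shared by the Malcolmson and the Cuntz preorder and suffice for the
  whole quotient construction. Reflexivity is \<open>leq_mult\<close> with identity factors;
  \<open>leq_diag_left\<close> treats one summand, and swapping blocks gives the other.\<close>

locale mat_preorder =
  fixes leq :: "'a::ring_1 mat \<Rightarrow> 'a mat \<Rightarrow> bool"
  assumes leq_rect: "leq A B \<Longrightarrow> A \<in> rect_mats \<and> B \<in> rect_mats"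
    and leq_trans: "leq A B \<Longrightarrow> leq B C \<Longrightarrow> leq A C"
    and leq_mult: "B \<in> rect_mats \<Longrightarrow> 0 < m \<Longrightarrow> 0 < n \<Longrightarrow> C \<in> carrier_mat m (dim_row B) \<Longrightarrow>
      D \<in> carrier_mat (dim_col B) n \<Longrightarrow> leq (C * B * D) B"
    and leq_diag_left: "leq A B \<Longrightarrow> X \<in> rect_mats \<Longrightarrow> leq (diag_mat2 A X) (diag_mat2 B X)"
begin

lemma leq_refl: "A \<in> rect_mats \<Longrightarrow> leq A A"
  using leq_mult[of A "dim_row A" "dim_col A" "1\<^sub>m (dim_row A)" "1\<^sub>m (dim_col A)"]
  by (auto simp: rect_mats_def)

lemma leq_diag_commute:
  assumes "A \<in> rect_mats" "B \<in> rect_mats"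
  shows "leq (diag_mat2 A B) (diag_mat2 B A)"
proof -
  obtain P Q where "P \<in> carrier_mat (dim_row A + dim_row B) (dim_row B + dim_row A)"
    "Q \<in> carrier_mat (dim_col B + dim_col A) (dim_col A + dim_col B)"
    and eq: "diag_mat2 A B = P * diag_mat2 B A * Q"
    using diag_mat2_commute by blast
  then show ?thesis
    unfolding eq using assms by (intro leq_mult) (auto simp: rect_mats_def)
qed

lemma leq_diag:
  assumes "leq A B" "leq X Y"
  shows "leq (diag_mat2 A X) (diag_mat2 B Y)"
proof -
  have rect: "A \<in> rect_mats" "B \<in> rect_mats" "X \<in> rect_mats" "Y \<in> rect_mats"
    using assms leq_rect by auto
  have "leq (diag_mat2 A X) (diag_mat2 B X)"
    using assms rect leq_diag_left by blast
  \<comment> \<open>The second summand is replaced by swapping it to the front, replacing it there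
    and swapping back.\<close>
  moreover have "leq (diag_mat2 B X) (diag_mat2 X B)" "leq (diag_mat2 X B) (diag_mat2 Y B)"
    "leq (diag_mat2 Y B) (diag_mat2 B Y)"
    using assms rect leq_diag_left leq_diag_commute by blast+
  ultimately show ?thesis
    using leq_trans by blast
qed

lemma leq_diag_zero:
  assumes "A \<in> rect_mats"
  shows "leq (diag_mat2 (0\<^sub>m m n) A) A"
  unfolding diag_mat2_zero_left
  using assms by (intro leq_mult[where m = "m + dim_row A" and n = "n + dim_col A"])
    (auto simp: rect_mats_def)

lemma leq_zero_diag:
  assumes "A \<in> rect_mats"
  shows "leq A (diag_mat2 (0\<^sub>m m n) A)"
proof -
  have "leq (four_block_mat (0\<^sub>m (dim_row A) m) (1\<^sub>m (dim_row A)) (0\<^sub>m 0 m) (0\<^sub>m 0 (dim_row A))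
      * diag_mat2 (0\<^sub>m m n) A *
      four_block_mat (0\<^sub>m n (dim_col A)) (0\<^sub>m n 0) (1\<^sub>m (dim_col A)) (0\<^sub>m (dim_col A) 0))
      (diag_mat2 (0\<^sub>m m n) A)"
    using assms by (intro leq_mult[where m = "dim_row A" and n = "dim_col A"])
      (auto simp: rect_mats_def)
  then show ?thesis
    by (simp only: diag_mat2_zero_left_compress[symmetric])
qed

lemma mem_mat_class: "B \<in> mat_class leq A \<longleftrightarrow> leq A B \<and> leq B A"
  using leq_rect by (auto simp: mat_class_def mat_equiv_def)

lemma mat_class_eq:
  assumes "leq A B" "leq B A"
  shows "mat_class leq A = mat_class leq B"
  using assms by (auto simp: mem_mat_class intro: leq_trans)

lemma carrier_mat_class_monoid: "carrier (mat_class_monoid leq) = mat_class leq ` rect_mats"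
  by (auto simp: mat_class_monoid_def mat_class_def quotient_def)

lemma mult_mat_class:
  assumes "A \<in> rect_mats" "B \<in> rect_mats"
  shows "mat_class leq A \<otimes>\<^bsub>mat_class_monoid leq\<^esub> mat_class leq B = mat_class leq (diag_mat2 A B)"
proof -
  \<comment> \<open>All classes in the union that defines the product coincide, and the index sets
    are nonempty, so the union collapses to one class.\<close>
  have "mat_class leq (diag_mat2 A' B') = mat_class leq (diag_mat2 A B)"
    if "A' \<in> mat_class leq A" "B' \<in> mat_class leq B" for A' B'
    using that by (auto simp: mem_mat_class intro!: mat_class_eq leq_diag)
  then have "(\<Union>A'\<in>mat_class leq A. \<Union>B'\<in>mat_class leq B. mat_class leq (diag_mat2 A' B')) =
      (\<Union>A'\<in>mat_class leq A. \<Union>B'\<in>mat_class leq B. mat_class leq (diag_mat2 A B))"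
    by (intro SUP_cong refl)
  moreover have "mat_class leq A \<noteq> {}" "mat_class leq B \<noteq> {}"
    using assms leq_refl mem_mat_class by blast+
  ultimately show ?thesis
    by (simp add: mat_class_monoid_def)
qed

text \<open>Associativity is an equality of matrices; the unit law and commutativity hold only up to
  equivalence.\<close>

lemma comm_monoid_mat_class: "comm_monoid (mat_class_monoid leq)"
proof -
  have one: "\<one>\<^bsub>mat_class_monoid leq\<^esub> = mat_class leq (0\<^sub>m 1 1)"
    by (simp add: mat_class_monoid_def)
  have zero: "(0\<^sub>m 1 1 :: 'a mat) \<in> rect_mats"
    by (simp add: rect_mats_def)
  show ?thesis
  proof (rule comm_monoidI)
    fix x assume "x \<in> carrier (mat_class_monoid leq)"
    then obtain A where A: "A \<in> rect_mats" "x = mat_class leq A"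
      by (auto simp: carrier_mat_class_monoid)
    have "mat_class leq (diag_mat2 (0\<^sub>m 1 1) A) = mat_class leq A"
      using A leq_diag_zero leq_zero_diag by (intro mat_class_eq)
    then show "\<one>\<^bsub>mat_class_monoid leq\<^esub> \<otimes>\<^bsub>mat_class_monoid leq\<^esub> x = x"
      unfolding one A by (simp only: mult_mat_class zero A)
  next
    fix x y assume "x \<in> carrier (mat_class_monoid leq)" "y \<in> carrier (mat_class_monoid leq)"
    then obtain A B where AB: "A \<in> rect_mats" "x = mat_class leq A" "B \<in> rect_mats" "y = mat_class leq B"
      by (auto simp: carrier_mat_class_monoid)
    have "mat_class leq (diag_mat2 A B) = mat_class leq (diag_mat2 B A)"
      using AB leq_diag_commute by (intro mat_class_eq)
    then show "x \<otimes>\<^bsub>mat_class_monoid leq\<^esub> y = y \<otimes>\<^bsub>mat_class_monoid leq\<^esub> x"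
      using AB by (simp add: mult_mat_class)
  qed (use zero in \<open>auto simp: one carrier_mat_class_monoid mult_mat_class diag_mat2_rect
        diag_mat2_assoc\<close>)
qed

text \<open>The order on classes asks for some comparable representatives; by transitivity any other
  representatives are then comparable too.\<close>

lemma mat_class_order_iff:
  assumes "A \<in> rect_mats" "B \<in> rect_mats"
  shows "(mat_class leq A, mat_class leq B) \<in> mat_class_order leq \<longleftrightarrow> leq A B"
proof -
  have "mat_class leq A \<in> rect_mats // mat_equiv leq" "mat_class leq B \<in> rect_mats // mat_equiv leq"
    using assms by (auto simp: quotient_def mat_class_def)
  moreover have "A \<in> mat_class leq A" "B \<in> mat_class leq B"
    using assms leq_refl by (auto simp: mem_mat_class)
  ultimately show ?thesis
    unfolding mat_class_order_def mem_Collect_eq prod.case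
    by (metis leq_trans mem_mat_class)
qed

lemma mat_class_orderE:
  assumes "(x, y) \<in> mat_class_order leq"
  obtains A B where "A \<in> rect_mats" "B \<in> rect_mats" "x = mat_class leq A" "y = mat_class leq B"
    "leq A B"
proof -
  obtain A B where "A \<in> rect_mats" "B \<in> rect_mats" "x = mat_class leq A" "y = mat_class leq B"
    using assms by (auto simp: mat_class_order_def quotient_def mat_class_def)
  then show thesis
    using that assms mat_class_order_iff by metis
qed

lemma partial_order_mat_class:
  "partial_order_on (carrier (mat_class_monoid leq)) (mat_class_order leq)"
  unfolding partial_order_on_def preorder_on_def
proof (intro conjI)
  show "mat_class_order leq \<subseteq>
      carrier (mat_class_monoid leq) \<times> carrier (mat_class_monoid leq)"
    by (auto simp: carrier_mat_class_monoid elim!: mat_class_orderE)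
  show "refl_on (carrier (mat_class_monoid leq)) (mat_class_order leq)"
    by (auto simp: refl_on_def carrier_mat_class_monoid mat_class_order_iff leq_refl)
  show "trans (mat_class_order leq)"
    by (rule transI) (metis leq_rect leq_trans mat_class_order_iff mat_class_orderE mem_mat_class leq_refl)
  show "antisym (mat_class_order leq)"
    by (rule antisymI) (metis mat_class_eq mat_class_order_iff mat_class_orderE)
qed

end

text \<open>If \<open>l1\<close> implies \<open>l2\<close>, then \<open>l1\<close>-equivalent
  matrices are \<open>l2\<close>-equivalent, so classes map to classes; sums and units agree because
  both monoids use \<open>diag_mat2\<close> and the same zero matrix.\<close>

lemma mat_class_hom:
  assumes "mat_preorder l1" "mat_preorder l2"
    and le: "\<And>A B. l1 A B \<Longrightarrow> l2 A B"
  shows "\<exists>h. (\<forall>A\<in>rect_mats. h (mat_class l1 A) = mat_class l2 A) \<and>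
    order_preserving_monoid_hom (mat_class_monoid l1) (mat_class_order l1)
      (mat_class_monoid l2) (mat_class_order l2) h"
proof -
  interpret P: mat_preorder l1 by fact
  interpret Q: mat_preorder l2 by fact
  \<comment> \<open>The choice of representative is harmless, since all members of an
    \<open>l1\<close>-class lie in one \<open>l2\<close>-class.\<close>
  define h where "h = (\<lambda>X. mat_class l2 (SOME A. A \<in> X))"
  have h: "h (mat_class l1 A) = mat_class l2 A" if "A \<in> rect_mats" for A
  proof -
    have "A \<in> mat_class l1 A"
      using that P.leq_refl by (simp add: P.mem_mat_class)
    then have "(SOME B. B \<in> mat_class l1 A) \<in> mat_class l1 A"
      by (rule someI)
    then show ?thesis
      unfolding h_def by (intro Q.mat_class_eq le) (auto simp: P.mem_mat_class)
  qed
  have zero: "(0\<^sub>m 1 1 :: 'a mat) \<in> rect_mats"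
    by (simp add: rect_mats_def)
  have "h \<in> hom (mat_class_monoid l1) (mat_class_monoid l2)"
    by (rule homI) (auto simp: P.carrier_mat_class_monoid Q.carrier_mat_class_monoid h
        P.mult_mat_class Q.mult_mat_class diag_mat2_rect)
  moreover have "h \<one>\<^bsub>mat_class_monoid l1\<^esub> = \<one>\<^bsub>mat_class_monoid l2\<^esub>"
    using h[OF zero] by (simp add: mat_class_monoid_def)
  moreover have "(h x, h y) \<in> mat_class_order l2" if "(x, y) \<in> mat_class_order l1" for x y
    using that by (auto elim!: P.mat_class_orderE simp: h Q.mat_class_order_iff le)
  ultimately show ?thesis
    using h P.comm_monoid_mat_class Q.comm_monoid_mat_class
      P.partial_order_mat_class Q.partial_order_mat_class
    unfolding order_preserving_monoid_hom_def by blast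
qed

section \<open>The Malcolmson preorder\<close>

lemma malcolmson_step_diag:
  assumes "malcolmson_step A B" "X \<in> rect_mats"
  shows "malcolmson_step (diag_mat2 A X) (diag_mat2 B X)"
proof -
  have rect: "A \<in> rect_mats" "B \<in> rect_mats"
    using assms by (auto simp: malcolmson_step_def)
  from assms(1) consider (mult) C D where "C \<in> rect_mats" "D \<in> rect_mats"
      "dim_col C = dim_row B" "dim_row D = dim_col B" "A = C * B * D"
    | (upper) C D E where "C \<in> rect_mats" "D \<in> rect_mats" "E \<in> rect_mats"
      "dim_row E = dim_row C" "dim_col E = dim_col D" "B = upper_mat C E D" "A = diag_mat2 C D"
    unfolding malcolmson_step_def by blast
  then show ?thesis
  proof cases
    case mult
    \<comment> \<open>The new summand is carried along by identity blocks in both factors.\<close>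
    let ?C = "diag_mat2 C (1\<^sub>m (dim_row X))" and ?D = "diag_mat2 D (1\<^sub>m (dim_col X))"
    have "diag_mat2 A X = ?C * diag_mat2 B X * ?D"
      using mult by (simp add: diag_mat2_mult)
    moreover have "dim_col ?C = dim_row (diag_mat2 B X)" "dim_row ?D = dim_col (diag_mat2 B X)"
      using mult by simp_all
    ultimately show ?thesis
      unfolding malcolmson_step_def using mult rect diag_mat2_rect by blast
  next
    case upper
    \<comment> \<open>\<open>E'\<close> is \<open>E\<close> followed by \<open>dim_col X\<close>
      zero columns: \<open>X\<close> joins the lower diagonal block, so the corner only has to
      become wider.\<close>
    define E' where "E' =
      four_block_mat E (0\<^sub>m (dim_row C) (dim_col X)) (0\<^sub>m 0 (dim_col E)) (0\<^sub>m 0 (dim_col X))"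
    have "diag_mat2 B X = upper_mat C E' (diag_mat2 D X)"
      using upper by (simp add: upper_mat_diag_mat2 E'_def)
    moreover have "diag_mat2 A X = diag_mat2 C (diag_mat2 D X)"
      using upper by (simp add: diag_mat2_assoc)
    moreover have "dim_row E' = dim_row C" "dim_col E' = dim_col (diag_mat2 D X)" "E' \<in> rect_mats"
      using upper by (auto simp: E'_def rect_mats_def)
    ultimately show ?thesis
      unfolding malcolmson_step_def using upper rect diag_mat2_rect by blast
  qed
qed

lemma mat_preorder_malcolmson: "mat_preorder malcolmson_le"
proof
  fix A B C :: "'a mat"
  assume "malcolmson_le A B" "malcolmson_le B C"
  then show "malcolmson_le A C"
    by (auto simp: malcolmson_le_def)
next
  fix B C D :: "'a mat" and m n :: nat
  assume *: "B \<in> rect_mats" "0 < m" "0 < n" "C \<in> carrier_mat m (dim_row B)"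
    "D \<in> carrier_mat (dim_col B) n"
  then have "malcolmson_step (C * B * D) B"
    unfolding malcolmson_step_def
    by (intro conjI disjI1 bexI[of _ C] bexI[of _ D]) (auto simp: rect_mats_def)
  with * show "malcolmson_le (C * B * D) B"
    by (auto simp: malcolmson_le_def rect_mats_def)
next
  fix A B X :: "'a mat"
  assume *: "malcolmson_le A B" "X \<in> rect_mats"
  from * have "malcolmson_step\<^sup>*\<^sup>* A B"
    by (simp add: malcolmson_le_def)
  then have "malcolmson_step\<^sup>*\<^sup>* (diag_mat2 A X) (diag_mat2 B X)"
    by induction (auto intro: malcolmson_step_diag[OF _ *(2)] rtranclp.rtrancl_into_rtrancl)
  with * show "malcolmson_le (diag_mat2 A X) (diag_mat2 B X)"
    by (auto simp: malcolmson_le_def diag_mat2_rect)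
qed (auto simp: malcolmson_le_def)

subsection \<open>C*-seminorms on matrices\<close>

lemma scaleC_zero_right [simp]: "scaleC c (0::'a::unital_cstar_algebra) = 0"
  using scaleC_add_right[of c "0::'a" 0] by simp

lemma scaleC_zero_left [simp]: "scaleC 0 (x::'a::unital_cstar_algebra) = 0"
  using scaleC_of_real[of 0 x] by simp

lemma scaleC_one [simp]: "scaleC 1 (x::'a::unital_cstar_algebra) = x"
  using scaleC_of_real[of 1 x] by simp

lemma scaleC_minus_one [simp]: "scaleC (- 1) (x::'a::unital_cstar_algebra) = - x"
  using scaleC_of_real[of "- 1" x] by simp

lemma scaleC_minus_right: "scaleC c (- x) = - scaleC c (x::'a::unital_cstar_algebra)"
  using scaleC_add_right[of c x "- x"] by (simp add: eq_neg_iff_add_eq_0 add.commute)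

lemma scaleC_minus_left: "scaleC (- c) x = - scaleC c (x::'a::unital_cstar_algebra)"
  using scaleC_add_left[of c "- c" x] by (simp add: eq_neg_iff_add_eq_0 add.commute)

lemma scaleC_diff_right: "scaleC c (x - y) = scaleC c x - scaleC c (y::'a::unital_cstar_algebra)"
  using scaleC_add_right[of c x "- y"] by (simp add: scaleC_minus_right)

lemma scaleC_sum_right:
  "scaleC c (sum f S) = (\<Sum>x\<in>S. scaleC c (f x :: 'a::unital_cstar_algebra))"
  by (induction S rule: infinite_finite_induct) (simp_all add: scaleC_add_right)

lemma star_zero [simp]: "star (0::'a::unital_cstar_algebra) = 0"
  using star_add[of "0::'a" 0] by simp

lemma star_one [simp]: "star (1::'a::unital_cstar_algebra) = 1"
  using star_mult[of "star 1" "1::'a"] star_star[of "1::'a"] by simp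

lemma star_minus: "star (- x) = - star (x::'a::unital_cstar_algebra)"
  using star_add[of x "- x"] by (simp add: eq_neg_iff_add_eq_0 add.commute)

lemma star_diff: "star (x - y) = star x - star (y::'a::unital_cstar_algebra)"
  using star_add[of x "- y"] by (simp add: star_minus)

lemma star_sum: "star (sum f S) = (\<Sum>x\<in>S. star (f x :: 'a::unital_cstar_algebra))"
  by (induction S rule: infinite_finite_induct) (simp_all add: star_add)

abbreviation scaleC_mat :: "complex \<Rightarrow> 'a::unital_cstar_algebra mat \<Rightarrow> 'a mat" where
  "scaleC_mat c A \<equiv> map_mat (scaleC c) A"

lemma scaleC_mat_mult_left:
  fixes A :: "'a::unital_cstar_algebra mat"
  assumes "dim_col A = dim_row B"
  shows "scaleC_mat c A * B = scaleC_mat c (A * B)"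
  by (rule eq_matI)
    (use assms in \<open>auto simp: scalar_prod_def scaleC_sum_right scaleC_mult_left\<close>)

lemma scaleC_mat_mult_right:
  fixes A :: "'a::unital_cstar_algebra mat"
  assumes "dim_col A = dim_row B"
  shows "A * scaleC_mat c B = scaleC_mat c (A * B)"
  by (rule eq_matI)
    (use assms in \<open>auto simp: scalar_prod_def scaleC_sum_right scaleC_mult_right\<close>)

lemma dim_star_mat [simp]:
  "dim_row (star_mat A) = dim_col A" "dim_col (star_mat A) = dim_row A"
  by (simp_all add: star_mat_def)

lemma index_star_mat [simp]:
  "i < dim_col A \<Longrightarrow> j < dim_row A \<Longrightarrow> star_mat A $$ (i, j) = star (A $$ (j, i))"
  by (simp add: star_mat_def)

lemma star_mat_rect: "A \<in> rect_mats \<Longrightarrow> star_mat A \<in> rect_mats"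
  by (simp add: rect_mats_def)

lemma star_mat_star [simp]: "star_mat (star_mat A) = A"
  by (rule eq_matI) (auto simp: star_star)

lemma star_mat_mult:
  fixes A :: "'a::unital_cstar_algebra mat"
  assumes "dim_col A = dim_row B"
  shows "star_mat (A * B) = star_mat B * star_mat A"
  by (rule eq_matI) (use assms in \<open>auto simp: scalar_prod_def star_sum star_mult\<close>)

lemma star_mat_one [simp]: "star_mat (1\<^sub>m n) = 1\<^sub>m n"
  by (rule eq_matI) auto

lemma star_mat_four_block:
  assumes "dim_row B = dim_row A" "dim_col C = dim_col A"
    "dim_row C = dim_row D" "dim_col B = dim_col D"
  shows "star_mat (four_block_mat A B C D) =
    four_block_mat (star_mat A) (star_mat C) (star_mat B) (star_mat D)"
  by (rule eq_matI) (use assms in auto)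

lemma star_mat_zero [simp]: "star_mat (0\<^sub>m m n) = 0\<^sub>m n m"
  by (rule eq_matI) auto

lemma four_block_mat_empty:
  "four_block_mat A (0\<^sub>m (dim_row A) 0) (0\<^sub>m 0 (dim_col A)) (0\<^sub>m 0 0) = A"
  by (rule eq_matI) auto

section \<open>Estimates for C*-seminorms on rectangular matrices\<close>

text \<open>The estimates are used twice: for each member of the family, to bound the supremum
  \<open>cstar_mat_norm\<close>, and then for that supremum, which is again a C*-seminorm.\<close>

locale cstar_seminorm =
  fixes p :: "'a::unital_cstar_algebra mat \<Rightarrow> real"
  assumes seminorm: "mat_cstar_seminorm p"
begin

lemma nonneg: "A \<in> rect_mats \<Longrightarrow> 0 \<le> p A"
  and add_le: "A \<in> rect_mats \<Longrightarrow> B \<in> rect_mats \<Longrightarrow> dim_row A = dim_row B \<Longrightarrow>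
    dim_col A = dim_col B \<Longrightarrow> p (A + B) \<le> p A + p B"
  and scaleC: "A \<in> rect_mats \<Longrightarrow> p (scaleC_mat c A) = cmod c * p A"
  and mult_le: "A \<in> rect_mats \<Longrightarrow> B \<in> rect_mats \<Longrightarrow> dim_col A = dim_row B \<Longrightarrow>
    p (A * B) \<le> p A * p B"
  and cstar: "A \<in> rect_mats \<Longrightarrow> p (star_mat A * A) = (p A)\<^sup>2"
  and single_le: "p (mat 1 1 (\<lambda>_. a)) \<le> norm a"
  using seminorm unfolding mat_cstar_seminorm_def by blast+

lemma mult_mono:
  assumes "A \<in> rect_mats" "B \<in> rect_mats" "dim_col A = dim_row B" "p A \<le> a" "p B \<le> b"
  shows "p (A * B) \<le> a * b"
proof -
  have "p A * p B \<le> a * b"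
    using assms nonneg by (intro Rings.mult_mono) (auto intro: order_trans)
  then show ?thesis
    using mult_le assms by fastforce
qed

lemma add_mono:
  assumes "A \<in> rect_mats" "B \<in> rect_mats" "dim_row A = dim_row B" "dim_col A = dim_col B"
    "p A \<le> a" "p B \<le> b"
  shows "p (A + B) \<le> a + b"
  using add_le[of A B] assms by linarith

lemma diff_mono:
  assumes "A \<in> rect_mats" "B \<in> rect_mats" "dim_row A = dim_row B" "dim_col A = dim_col B"
    "p A \<le> a" "p B \<le> b"
  shows "p (A - B) \<le> a + b"
proof -
  have "A - B = A + scaleC_mat (- 1) B"
    by (rule eq_matI) (use assms in auto)
  moreover have "p (scaleC_mat (- 1) B) = p B"
    using assms by (simp add: scaleC)
  moreover have "scaleC_mat (- 1) B \<in> rect_mats"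
    using assms by (simp add: rect_mats_def)
  ultimately show ?thesis
    using add_le[of A "scaleC_mat (- 1) B"] assms by simp
qed

lemma zero [simp]: "0 < m \<Longrightarrow> 0 < n \<Longrightarrow> p (0\<^sub>m m n) = 0"
proof -
  assume "0 < m" "0 < n"
  moreover have "scaleC_mat 0 (0\<^sub>m m n) = (0\<^sub>m m n :: 'a mat)"
    by (rule eq_matI) auto
  ultimately show ?thesis
    using scaleC[of "0\<^sub>m m n" 0] by (simp add: rect_mats_def)
qed

text \<open>The C*-identity and submultiplicativity bound the square of \<open>p A\<close> by
  \<open>p (star_mat A) * p A\<close>; then \<open>p A\<close> is cancelled unless it
  vanishes.\<close>

lemma star_mat_le:
  assumes "A \<in> rect_mats" shows "p A \<le> p (star_mat A)"
proof -
  have "p A * p A \<le> p (star_mat A) * p A"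
    using mult_le[of "star_mat A" A] cstar[of A] assms
    by (simp add: star_mat_rect power2_eq_square)
  then show ?thesis
    using nonneg[OF assms] nonneg[OF star_mat_rect[OF assms]]
    by (cases "p A = 0") (auto simp: mult_le_cancel_right)
qed

lemma star_mat [simp]: "A \<in> rect_mats \<Longrightarrow> p (star_mat A) = p A"
  using star_mat_le[of A] star_mat_le[of "star_mat A"] by (simp add: star_mat_rect)

text \<open>By the C*-identity \<open>p (1\<^sub>m n)\<close> equals its own square, so it is 0 or
  1. The value 0 does occur, for the zero seminorm.\<close>

lemma one_le: "0 < n \<Longrightarrow> p (1\<^sub>m n) \<le> 1"
proof -
  assume n: "0 < n"
  then have r: "1\<^sub>m n \<in> rect_mats"
    by (simp add: rect_mats_def)
  from cstar[OF this] have "p (1\<^sub>m n) * p (1\<^sub>m n) = p (1\<^sub>m n) * 1"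
    by (simp add: power2_eq_square)
  then show ?thesis
    unfolding mult_cancel_left by linarith
qed

lemma isometry_le:
  assumes "J \<in> rect_mats" "star_mat J * J = 1\<^sub>m n"
  shows "p J \<le> 1"
proof -
  have "0 < n"
    using arg_cong[OF assms(2), of dim_row] assms(1) by (simp add: rect_mats_def)
  then have "(p J)\<^sup>2 \<le> 1"
    using cstar[OF assms(1)] assms(2) one_le by metis
  then show ?thesis
    using power2_le_imp_le[of "p J" 1] by simp
qed

lemma four_block_le:
  assumes "A \<in> rect_mats" "B \<in> rect_mats" "C \<in> rect_mats" "D \<in> rect_mats"
    "dim_row B = dim_row A" "dim_col C = dim_col A"
    "dim_row C = dim_row D" "dim_col B = dim_col D"
  shows "p (four_block_mat A B C D) \<le> p A + p B + (p C + p D)"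
proof -
  \<comment> \<open>\<open>J1 m k\<close> and \<open>J2 m k\<close> are the isometric inclusions of
    the first \<open>m\<close> and of the last \<open>k\<close> coordinates; the blocks are
    assembled with them and their adjoints.\<close>
  define J1 where "J1 m k = four_block_mat (1\<^sub>m m) (0\<^sub>m m 0) (0\<^sub>m k m) (0\<^sub>m k 0 :: 'a mat)" for m k
  define J2 where "J2 m k = four_block_mat (0\<^sub>m m k) (0\<^sub>m m 0) (1\<^sub>m k) (0\<^sub>m k 0 :: 'a mat)" for m k
  have dims: "dim_row (J1 m k) = m + k" "dim_col (J1 m k) = m"
     "dim_row (J2 m k) = m + k" "dim_col (J2 m k) = k" for m k
    by (simp_all add: J1_def J2_def)
  have "star_mat (J1 m k) * J1 m k = 1\<^sub>m m" "star_mat (J2 m k) * J2 m k = 1\<^sub>m k" for m k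
    unfolding J1_def J2_def
    using four_block_mat_empty[of "1\<^sub>m m :: 'a mat"] four_block_mat_empty[of "1\<^sub>m k :: 'a mat"]
    by (simp_all add: star_mat_four_block four_block_mat_mult_dims)
  then have J: "p (J1 m k) \<le> 1" "p (J2 m k) \<le> 1" if "0 < m" "0 < k" for m k
    using that by (auto intro!: isometry_le simp: rect_mats_def dims)
  \<comment> \<open>Two blocks side by side are \<open>X\<close> and \<open>Y\<close> multiplied on
    the right by the adjoint inclusions and added; the two rows are stacked below in the same way,
    with the inclusions on the left.\<close>
  have row: "p (four_block_mat X Y (0\<^sub>m 0 (dim_col X)) (0\<^sub>m 0 (dim_col Y))) \<le> p X + p Y"
    if XY: "X \<in> rect_mats" "Y \<in> rect_mats" "dim_row X = dim_row Y" for X Y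
  proof -
    let ?c = "dim_col X" and ?d = "dim_col Y"
    have eq1: "X * star_mat (J1 ?c ?d) =
        four_block_mat X (0\<^sub>m (dim_row X) ?d) (0\<^sub>m 0 ?c) (0\<^sub>m 0 ?d)"
      by (subst (1) four_block_mat_empty[of X, symmetric])
        (simp add: J1_def star_mat_four_block four_block_mat_mult_dims)
    have eq2: "Y * star_mat (J2 ?c ?d) =
        four_block_mat (0\<^sub>m (dim_row Y) ?c) Y (0\<^sub>m 0 ?c) (0\<^sub>m 0 ?d)"
      by (subst (1) four_block_mat_empty[of Y, symmetric])
        (simp add: J2_def star_mat_four_block four_block_mat_mult_dims)
    have eq: "four_block_mat X Y (0\<^sub>m 0 ?c) (0\<^sub>m 0 ?d) =
        X * star_mat (J1 ?c ?d) + Y * star_mat (J2 ?c ?d)"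
      unfolding eq1 eq2 by (rule eq_matI) (use XY in auto)
    have "p (X * star_mat (J1 ?c ?d)) \<le> p X * 1" "p (Y * star_mat (J2 ?c ?d)) \<le> p Y * 1"
      by (rule mult_mono; use XY J[of ?c ?d] in \<open>auto simp: dims rect_mats_def\<close>)+
    then show ?thesis
      unfolding eq using XY by (intro add_mono) (auto simp: dims rect_mats_def)
  qed
  let ?X = "four_block_mat A B (0\<^sub>m 0 (dim_col A)) (0\<^sub>m 0 (dim_col B))"
  let ?Y = "four_block_mat C D (0\<^sub>m 0 (dim_col C)) (0\<^sub>m 0 (dim_col D))"
  let ?m = "dim_row A" and ?k = "dim_row D"
  have eq: "four_block_mat A B C D = J1 ?m ?k * ?X + J2 ?m ?k * ?Y"
    unfolding J1_def J2_def using assms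
    by (simp add: four_block_mat_mult_dims)
      (subst add_four_block_mat[of _ ?m "dim_col A" _ "dim_col D" _ ?k], auto)
  have "p (J1 ?m ?k * ?X) \<le> 1 * (p A + p B)"
  proof (rule mult_mono)
    show "p (J1 ?m ?k) \<le> 1"
      using assms by (intro J) (auto simp: rect_mats_def)
    show "p ?X \<le> p A + p B"
      using assms by (intro row) auto
  qed (use assms in \<open>simp_all add: dims rect_mats_def\<close>)
  moreover have "p (J2 ?m ?k * ?Y) \<le> 1 * (p C + p D)"
  proof (rule mult_mono)
    show "p (J2 ?m ?k) \<le> 1"
      using assms by (intro J) (auto simp: rect_mats_def)
    show "p ?Y \<le> p C + p D"
      using assms by (intro row) auto
  qed (use assms in \<open>simp_all add: dims rect_mats_def\<close>)
  ultimately show ?thesis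
    unfolding eq using assms by (intro add_mono) (auto simp: dims rect_mats_def)
qed

lemma diag_mat2_le:
  assumes "A \<in> rect_mats" "B \<in> rect_mats"
  shows "p (diag_mat2 A B) \<le> p A + p B"
  using four_block_le[of A "0\<^sub>m (dim_row A) (dim_col B)" "0\<^sub>m (dim_row B) (dim_col A)" B] assms
  by (simp add: diag_mat2_alt rect_mats_def)

text \<open>The bound does not depend on \<open>p\<close>, which makes the supremum over all
  C*-seminorms finite. It comes from splitting \<open>A\<close> into its entries.\<close>

lemma le_sum_norm:
  assumes "A \<in> rect_mats"
  shows "p A \<le> (\<Sum>ij\<in>{..<dim_row A} \<times> {..<dim_col A}. norm (A $$ ij))"
proof -
  let ?m = "dim_row A" and ?n = "dim_col A"
  have mn: "0 < ?m" "0 < ?n"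
    using assms by (auto simp: rect_mats_def)
  \<comment> \<open>\<open>e m i\<close> is the \<open>i\<close>-th standard column, an isometry; a
    matrix with the single entry \<open>a\<close> is the 1-by-1 matrix of \<open>a\<close> between a
    standard column and the adjoint of another.\<close>
  define e where "e m i = mat m 1 (\<lambda>(k, _). if k = i then 1 else (0::'a))" for m i
  have dims: "dim_row (e m i) = m" "dim_col (e m i) = 1" for m i
    by (simp_all add: e_def)
  have "star_mat (e m i) * e m i = 1\<^sub>m 1" if "i < m" for m i
    by (rule eq_matI) (use that in \<open>auto simp: e_def scalar_prod_def if_distrib cong: if_cong\<close>)
  then have e_le: "p (e m i) \<le> 1" if "i < m" for m i
    using that by (intro isometry_le[of _ 1]) (auto simp: rect_mats_def dims)
  have single: "p (mat ?m ?n (\<lambda>ij. if ij = (i, j) then a else 0)) \<le> norm a"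
    if "i < ?m" "j < ?n" for i j a
  proof -
    have "mat ?m ?n (\<lambda>ij. if ij = (i, j) then a else 0) =
        e ?m i * mat 1 1 (\<lambda>_. a) * star_mat (e ?n j)"
      by (rule eq_matI) (use that in \<open>auto simp: e_def scalar_prod_def\<close>)
    moreover have "p (e ?m i * mat 1 1 (\<lambda>_. a) * star_mat (e ?n j)) \<le> 1 * norm a * 1"
      using that e_le single_le[of a] mn
      by (intro mult_mono) (auto simp: rect_mats_def dims)
    ultimately show ?thesis
      by simp
  qed
  \<comment> \<open>Induction on the set \<open>S\<close> of entries that are kept, the others being
    replaced by 0.\<close>
  have "p (mat ?m ?n (\<lambda>ij. if ij \<in> S then A $$ ij else 0)) \<le> (\<Sum>ij\<in>S. norm (A $$ ij))"
    if "finite S" "S \<subseteq> {..<?m} \<times> {..<?n}" for S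
    using that
  proof induction
    case empty
    have "mat ?m ?n (\<lambda>ij. if ij \<in> {} then A $$ ij else 0) = 0\<^sub>m ?m ?n"
      by (rule eq_matI) auto
    then show ?case
      using mn by simp
  next
    case (insert ij S)
    obtain i j where ij: "ij = (i, j)" "i < ?m" "j < ?n"
      using insert.prems by auto
    have "mat ?m ?n (\<lambda>kl. if kl \<in> insert ij S then A $$ kl else 0) =
        mat ?m ?n (\<lambda>kl. if kl = (i, j) then A $$ ij else 0) +
        mat ?m ?n (\<lambda>kl. if kl \<in> S then A $$ kl else 0)"
      by (rule eq_matI) (use insert.hyps ij in auto)
    moreover have "p \<dots> \<le> norm (A $$ ij) + (\<Sum>ij\<in>S. norm (A $$ ij))"
      using insert mn by (intro add_mono single ij) (auto simp: rect_mats_def)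
    ultimately show ?case
      using insert.hyps by simp
  qed
  from this[of "{..<?m} \<times> {..<?n}"]
  have "p (mat ?m ?n (\<lambda>ij. if ij \<in> {..<?m} \<times> {..<?n} then A $$ ij else 0)) \<le>
      (\<Sum>ij\<in>{..<?m} \<times> {..<?n}. norm (A $$ ij))"
    by simp
  moreover have "mat ?m ?n (\<lambda>ij. if ij \<in> {..<?m} \<times> {..<?n} then A $$ ij else 0) = A"
    by (rule eq_matI) auto
  ultimately show ?thesis
    by simp
qed

section \<open>Neumann series and approximate resolvents\<close>

text \<open>\<open>y\<close> is the sum of the first \<open>N\<close> powers of \<open>a\<close>,
  starting with the identity, and \<open>r\<close> is the \<open>N\<close>-th power. The induction
  passes to \<open>1\<^sub>m n + a * y\<close> and \<open>a * r\<close>, and 1/(1 - \<rho>) is the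
  fixed point of the resulting recursion for the bound.\<close>

lemma neumann:
  assumes a: "a \<in> carrier_mat n n" "0 < n" and \<rho>: "p a \<le> \<rho>" "\<rho> < 1"
  shows "\<exists>y\<in>carrier_mat n n. \<exists>r\<in>carrier_mat n n.
    y * (1\<^sub>m n - a) = 1\<^sub>m n - r \<and> (1\<^sub>m n - a) * y = 1\<^sub>m n - r \<and>
    p r \<le> \<rho> ^ N \<and> p y \<le> 1 / (1 - \<rho>)"
proof (induction N)
  case 0
  show ?case
    using a \<rho>
    by (intro bexI[of _ "0\<^sub>m n n"] bexI[of _ "1\<^sub>m n"]) (auto simp: one_le)
next
  case (Suc N)
  then obtain y r where yr: "y \<in> carrier_mat n n" "r \<in> carrier_mat n n"
    "y * (1\<^sub>m n - a) = 1\<^sub>m n - r" "(1\<^sub>m n - a) * y = 1\<^sub>m n - r" "p r \<le> \<rho> ^ N" "p y \<le> 1 / (1 - \<rho>)"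
    by blast
  have rect: "a \<in> rect_mats" "y \<in> rect_mats" "r \<in> rect_mats" "1\<^sub>m n \<in> rect_mats" "a * y \<in> rect_mats"
    using a yr by (auto simp: rect_mats_def)
  have carr: "1\<^sub>m n - a \<in> carrier_mat n n" "a * y \<in> carrier_mat n n" "a * r \<in> carrier_mat n n"
    "1\<^sub>m n \<in> carrier_mat n n"
    using a yr by auto
  have ar: "a * (1\<^sub>m n - r) = a - a * r"
    using mult_minus_distrib_mat[OF a(1) carr(4) yr(2)] a by simp
  have "(1\<^sub>m n + a * y) * (1\<^sub>m n - a) = (1\<^sub>m n - a) + a * (y * (1\<^sub>m n - a))"
    using a yr carr by (simp add: add_mult_distrib_mat[OF carr(4,2,1)] assoc_mult_mat[OF a(1) yr(1) carr(1)])
  also have "\<dots> = (1\<^sub>m n - a) + (a - a * r)"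
    by (simp add: yr ar)
  also have "\<dots> = 1\<^sub>m n - a * r"
    by (rule eq_matI) (use a yr in auto)
  finally have left: "(1\<^sub>m n + a * y) * (1\<^sub>m n - a) = 1\<^sub>m n - a * r" .
  \<comment> \<open>The recursion multiplies by \<open>a\<close> on the left, so the second identity
    needs \<open>a\<close> to be moved past \<open>1\<^sub>m n - a\<close>.\<close>
  have comm: "(1\<^sub>m n - a) * a = a * (1\<^sub>m n - a)"
    using a by (simp add: minus_mult_distrib_mat[OF carr(4) a(1) a(1)] mult_minus_distrib_mat[OF a(1) carr(4) a(1)])
  have "(1\<^sub>m n - a) * (1\<^sub>m n + a * y) = (1\<^sub>m n - a) + (1\<^sub>m n - a) * (a * y)"
    by (simp only: mult_add_distrib_mat[OF carr(1,4,2)] right_mult_one_mat[OF carr(1)])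
  also have "(1\<^sub>m n - a) * (a * y) = (1\<^sub>m n - a) * a * y"
    using assoc_mult_mat[OF carr(1) a(1) yr(1)] by simp
  also have "\<dots> = a * (1\<^sub>m n - r)"
    unfolding comm using assoc_mult_mat[OF a(1) carr(1) yr(1)] by (simp add: yr)
  also have "(1\<^sub>m n - a) + a * (1\<^sub>m n - r) = 1\<^sub>m n - a * r"
    unfolding ar by (rule eq_matI) (use a yr in auto)
  finally have right: "(1\<^sub>m n - a) * (1\<^sub>m n + a * y) = 1\<^sub>m n - a * r" .
  have "p (a * r) \<le> \<rho> * \<rho> ^ N"
    using a yr rect \<rho> by (intro mult_mono) auto
  moreover have "p (1\<^sub>m n + a * y) \<le> 1 + \<rho> * (1 / (1 - \<rho>))"
    using a yr rect \<rho> by (intro add_mono mult_mono one_le) auto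
  moreover have "1 + \<rho> * (1 / (1 - \<rho>)) = 1 / (1 - \<rho>)"
    using \<rho> by (simp add: field_simps)
  ultimately show ?case
    using left right carr by (intro bexI[of _ "1\<^sub>m n + a * y"] bexI[of _ "a * r"]) auto
qed

text \<open>The shift by \<open>\<i>L\<close> with \<open>L\<close> large makes the Neumann series for the resolvent of a
  self-adjoint element at \<open>- \<i>\<mu>\<close> converge, because \<open>\<parallel>h - \<i>L\<parallel>\<^sup>2 \<le> \<parallel>h\<parallel>\<^sup>2 + L\<^sup>2\<close>; its partial
  sums replace the resolvent, so that no completeness is needed.\<close>

lemma approximate_resolvent:
  assumes h: "h \<in> carrier_mat n n" "0 < n" "star_mat h = h" and pos: "0 < \<mu>" "0 < \<eta>"
  shows "\<exists>y\<in>carrier_mat n n. \<exists>r\<in>carrier_mat n n.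
    p y \<le> 2 / \<mu> \<and> p r \<le> \<eta> \<and>
    y * h = 1\<^sub>m n - (scaleC_mat (\<i> * \<mu>) y + r) \<and> h * y = 1\<^sub>m n - (scaleC_mat (\<i> * \<mu>) y + r)"
proof -
  let ?I = "1\<^sub>m n :: 'a mat"
  have rect: "h \<in> rect_mats" "?I \<in> rect_mats"
    using h by (auto simp: rect_mats_def)
  define M where "M = p h"
  have "0 \<le> M"
    using nonneg rect by (simp add: M_def)
  \<comment> \<open>With \<open>L * \<mu> = M\<^sup>2\<close> the bound
    \<open>L\<^sup>2 + M\<^sup>2\<close> for the square of \<open>p g\<close> is at most the square
    of L + \<mu>/2.\<close>
  define L where "L = M\<^sup>2 / \<mu>"
  have L: "0 \<le> L" "L * \<mu> = M\<^sup>2"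
    using pos by (auto simp: L_def)
  define g where "g = scaleC_mat (\<i> * L) ?I - h"
  have g: "g \<in> carrier_mat n n" "g \<in> rect_mats"
    using h by (auto simp: g_def rect_mats_def)
  have star_g: "star_mat g = scaleC_mat (- \<i> * L) ?I - h"
  proof (rule eq_matI)
    fix i j assume ij: "i < dim_row (scaleC_mat (- \<i> * L) ?I - h)" "j < dim_col (scaleC_mat (- \<i> * L) ?I - h)"
    then have "star_mat h $$ (i, j) = star (h $$ (j, i))"
      using h(1) by (intro index_star_mat) auto
    then have "star (h $$ (j, i)) = h $$ (i, j)"
      unfolding h(3) ..
    then show "star_mat g $$ (i, j) = (scaleC_mat (- \<i> * L) ?I - h) $$ (i, j)"
      using ij h by (auto simp: g_def star_diff star_scaleC)
  qed (use h in \<open>auto simp: g_def\<close>)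
  have sh: "scaleC_mat c ?I * x = scaleC_mat c x" "x * scaleC_mat c ?I = scaleC_mat c x"
    if "x \<in> carrier_mat n n" for c x
    using that by (simp_all add: scaleC_mat_mult_left scaleC_mat_mult_right)
  \<comment> \<open>The mixed terms cancel because \<open>h\<close> is self-adjoint, leaving the
    identity times \<open>L\<^sup>2\<close> plus \<open>h * h\<close>.\<close>
  have "star_mat g * g = scaleC_mat (- \<i> * L) g - h * g"
    unfolding star_g using h g by (subst minus_mult_distrib_mat[of _ n n]) (auto simp: sh)
  also have "h * g = scaleC_mat (\<i> * L) h - h * h"
    unfolding g_def using h by (subst mult_minus_distrib_mat[of _ n n]) (auto simp: sh)
  also have "scaleC_mat (- \<i> * L) g - (scaleC_mat (\<i> * L) h - h * h) = scaleC_mat (L\<^sup>2) ?I + h * h"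
  proof (rule eq_matI)
    fix i j assume ij: "i < dim_row (scaleC_mat (L\<^sup>2) ?I + h * h)" "j < dim_col (scaleC_mat (L\<^sup>2) ?I + h * h)"
    have "scaleC (- (\<i> * L)) (scaleC (\<i> * L) x - y) = scaleC (L\<^sup>2) x + scaleC (\<i> * L) y"
      for x y :: 'a
      by (simp add: scaleC_diff_right scaleC_scaleC scaleC_minus_left power2_eq_square algebra_simps)
    from this[of "?I $$ (i, j)" "h $$ (i, j)"] show "(scaleC_mat (- \<i> * L) g - (scaleC_mat (\<i> * L) h - h * h)) $$ (i, j) =
        (scaleC_mat (L\<^sup>2) ?I + h * h) $$ (i, j)"
      using ij h by (simp add: g_def)
  qed (use h in \<open>auto simp: g_def\<close>)
  finally have "star_mat g * g = scaleC_mat (L\<^sup>2) ?I + h * h" .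
  then have "(p g)\<^sup>2 = p (scaleC_mat (L\<^sup>2) ?I + h * h)"
    using cstar[OF g(2)] by simp
  also have "\<dots> \<le> L\<^sup>2 * 1 + M * M"
  proof (rule add_mono)
    show "p (scaleC_mat (L\<^sup>2) ?I) \<le> L\<^sup>2 * 1"
      using one_le[OF h(2)] rect by (subst scaleC) (auto simp: norm_power intro: mult_left_le)
    show "p (h * h) \<le> M * M"
      using rect h by (intro mult_mono) (auto simp: M_def)
  qed (use h in \<open>auto simp: rect_mats_def\<close>)
  also have "\<dots> \<le> (L + \<mu> / 2)\<^sup>2"
    using L by (simp add: power2_eq_square algebra_simps)
  finally have g_le: "p g \<le> L + \<mu> / 2"
    by (rule power2_le_imp_le) (use L pos in simp)
  \<comment> \<open>This factor makes \<open>1\<^sub>m n - c g\<close> equal to \<open>c\<close>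
    times (\<open>h\<close> shifted by \<i>\<mu>), while \<open>p (c g)\<close> is at most \<rho> <
    1.\<close>
  define c where "c = 1 / (\<i> * complex_of_real (\<mu> + L))"
  have c: "cmod c = 1 / (\<mu> + L)" "c * (\<i> * \<mu>) + c * (\<i> * L) = 1"
    using L pos by (auto simp: c_def norm_divide norm_mult field_simps simp flip: of_real_add)
  define \<rho> where "\<rho> = (L + \<mu> / 2) / (\<mu> + L)"
  have \<rho>: "0 \<le> \<rho>" "\<rho> < 1" "1 / (1 - \<rho>) = 2 * (\<mu> + L) / \<mu>"
    using L pos by (auto simp: \<rho>_def field_simps)
  define a where "a = scaleC_mat c g"
  have a: "a \<in> carrier_mat n n" "p a \<le> \<rho>"
    using g g_le L pos by (auto simp: a_def scaleC c \<rho>_def intro!: divide_right_mono)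
  have one_a: "?I - a = scaleC_mat c (scaleC_mat (\<i> * \<mu>) ?I + h)"
  proof (rule eq_matI)
    fix i j assume ij: "i < dim_row (scaleC_mat c (scaleC_mat (\<i> * \<mu>) ?I + h))"
      "j < dim_col (scaleC_mat c (scaleC_mat (\<i> * \<mu>) ?I + h))"
    have "scaleC (c * (\<i> * \<mu>)) x + scaleC (c * (\<i> * L)) x = x" for x :: 'a
      unfolding scaleC_add_left[symmetric] c by simp
    then have "x - scaleC (c * (\<i> * L)) x = scaleC (c * (\<i> * \<mu>)) x" for x :: 'a
      by (simp add: diff_eq_eq)
    then have "x - scaleC c (scaleC (\<i> * L) x - y) = scaleC c (scaleC (\<i> * \<mu>) x + y)" for x y :: 'a
      unfolding scaleC_diff_right scaleC_add_right scaleC_scaleC by (metis add_diff_eq diff_diff_eq2 diff_add_eq)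
    from this[of "?I $$ (i, j)" "h $$ (i, j)"] show "(?I - a) $$ (i, j) = scaleC_mat c (scaleC_mat (\<i> * \<mu>) ?I + h) $$ (i, j)"
      using ij h by (simp add: a_def g_def)
  qed (use h in \<open>auto simp: a_def g_def\<close>)
  obtain N where N: "\<rho> ^ N < \<eta>"
    using real_arch_pow_inv[OF pos(2) \<rho>(2)] by blast
  obtain x r where xr: "x \<in> carrier_mat n n" "r \<in> carrier_mat n n"
    "x * (?I - a) = ?I - r" "(?I - a) * x = ?I - r" "p r \<le> \<rho> ^ N" "p x \<le> 1 / (1 - \<rho>)"
    using neumann[OF a(1) h(2) a(2) \<rho>(2)] by blast
  \<comment> \<open>Rescaling by \<open>c\<close> turns an approximate inverse of
    \<open>1\<^sub>m n - a\<close> into one of the shifted \<open>h\<close>. In the norm bound the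
    factor \<mu> + \<open>L\<close> cancels, so 2/\<mu> is free of \<open>p h\<close>.\<close>
  define y where "y = scaleC_mat c x"
  have y: "y \<in> carrier_mat n n"
    using xr by (simp add: y_def)
  have "p y = 1 / (\<mu> + L) * p x"
    using xr h c by (simp add: y_def scaleC rect_mats_def)
  also have "\<dots> \<le> 1 / (\<mu> + L) * (2 * (\<mu> + L) / \<mu>)"
    using xr \<rho> L pos by (intro mult_left_mono) auto
  also have "\<dots> = 2 / \<mu>"
  proof -
    have "1 / t * (2 * t / \<mu>) = 2 / \<mu>" if "0 < t" for t
      using that by simp
    then show ?thesis
      using add_pos_nonneg[OF pos(1) L(1)] by blast
  qed
  finally have y_le: "p y \<le> 2 / \<mu>" .
  have "x * (?I - a) = y * (scaleC_mat (\<i> * \<mu>) ?I + h)"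
    unfolding one_a y_def using xr h by (simp add: scaleC_mat_mult_left scaleC_mat_mult_right)
  also have "\<dots> = scaleC_mat (\<i> * \<mu>) y + y * h"
    using h y by (subst mult_add_distrib_mat[of _ n n]) (auto simp: sh)
  finally have 1: "scaleC_mat (\<i> * \<mu>) y + y * h = ?I - r"
    using xr by simp
  have "(?I - a) * x = (scaleC_mat (\<i> * \<mu>) ?I + h) * y"
    unfolding one_a y_def using xr h by (simp add: scaleC_mat_mult_left scaleC_mat_mult_right)
  also have "\<dots> = scaleC_mat (\<i> * \<mu>) y + h * y"
    using h y by (subst add_mult_distrib_mat[of _ n n]) (auto simp: sh)
  finally have 2: "scaleC_mat (\<i> * \<mu>) y + h * y = ?I - r"
    using xr by simp
  \<comment> \<open>Matrix subtraction obeys the group laws only for matching dimensions, so the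
    rearrangement is done entrywise.\<close>
  have move: "v = w - (u + r)" if "u + v = w - r"
    "u \<in> carrier_mat n n" "v \<in> carrier_mat n n" "w \<in> carrier_mat n n" for u v w
  proof (rule eq_matI)
    fix i j assume ij: "i < dim_row (w - (u + r))" "j < dim_col (w - (u + r))"
    have "u $$ (i, j) + v $$ (i, j) = (u + v) $$ (i, j)"
      using that(2-4) xr(2) ij by simp
    also have "\<dots> = w $$ (i, j) - r $$ (i, j)"
      unfolding that(1) using that(2-4) xr(2) ij by simp
    finally    have "v $$ (i, j) = w $$ (i, j) - r $$ (i, j) - u $$ (i, j)"
      by (simp add: eq_diff_eq add.commute)
    also have "\<dots> = w $$ (i, j) - (u $$ (i, j) + r $$ (i, j))"
      by (simp add: algebra_simps)
    finally show "v $$ (i, j) = (w - (u + r)) $$ (i, j)"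
      using that(2-4) xr(2) ij by simp
  qed (use that xr in auto)
  have "y * h = ?I - (scaleC_mat (\<i> * \<mu>) y + r)" "h * y = ?I - (scaleC_mat (\<i> * \<mu>) y + r)"
    using move[OF 1] move[OF 2] h y by auto
  then show ?thesis
    using y_le xr y N by (intro bexI[of _ y] bexI[of _ r]) auto
qed

section \<open>The quantitative estimate for block upper triangular matrices\<close>

text \<open>For fixed matrices the bound tends to 0 with \<delta>: the first term controls the
  corner \<open>F\<close>, the second the lower diagonal error \<open>G\<close>.\<close>

lemma upper_mat_error:
  assumes C: "C \<in> carrier_mat m1 n1" and E: "E \<in> carrier_mat m1 n2" and D: "D \<in> carrier_mat m2 n2"
    and pos: "0 < m1" "0 < m2" "0 < n1" "0 < n2" and \<delta>: "0 < \<delta>" "\<delta> \<le> 1"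
  defines "H \<equiv> p (star_mat D * D)"
  shows "\<exists>L\<in>carrier_mat (m1 + m2) (m1 + m2). \<exists>R\<in>carrier_mat (n1 + n2) (n1 + n2).
    p (L * upper_mat C E D * R - diag_mat2 C D) \<le> p E * ((8 + 2 * H) * \<delta>) + sqrt (3 * ((4 + H) * \<delta>))"
proof -
  let ?I = "1\<^sub>m n2 :: 'a mat"
  define h where "h = star_mat D * D"
  have h: "h \<in> carrier_mat n2 n2"
    using D by (auto simp: h_def)
  have star_h: "star_mat h = h"
    by (simp add: h_def star_mat_mult)
  have H: "p h = H" "0 \<le> H"
    using nonneg[of h] h pos by (auto simp: H_def h_def rect_mats_def)
  have \<delta>2: "0 < \<delta>\<^sup>2" "\<delta>\<^sup>2 \<le> \<delta>" "\<delta>\<^sup>2 \<le> 1"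
    using \<delta> by (auto simp: power2_eq_square mult_le_one mult_left_le)
  \<comment> \<open>The tolerance \<open>\<delta>\<^sup>2\<close> in both resolvents absorbs the
    factor 2/\<delta> that \<open>z\<close> contributes later.\<close>
  obtain y r where y: "y \<in> carrier_mat n2 n2" "p y \<le> 2 / \<delta>\<^sup>2"
    and r: "r \<in> carrier_mat n2 n2" "p r \<le> \<delta>\<^sup>2"
    and yh: "y * h = ?I - (scaleC_mat (\<i> * (\<delta>\<^sup>2)) y + r)"
    using approximate_resolvent[OF h pos(4) star_h \<delta>2(1) \<delta>2(1)] by blast
  obtain z s where z: "z \<in> carrier_mat n2 n2" "p z \<le> 2 / \<delta>"
    and s: "s \<in> carrier_mat n2 n2" "p s \<le> \<delta>\<^sup>2"
    and hz: "h * z = ?I - (scaleC_mat (\<i> * \<delta>) z + s)"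
    using approximate_resolvent[OF h pos(4) star_h \<delta>(1) \<delta>2(1)] by blast
  \<comment> \<open>\<open>u\<close> and \<open>w\<close> are the defects of \<open>y\<close> as a
    left inverse and of \<open>z\<close> as a right inverse of \<open>h\<close>. Both are bounded
    independently of \<delta>, though not small.\<close>
  define u where "u = scaleC_mat (\<i> * (\<delta>\<^sup>2)) y + r"
  define w where "w = scaleC_mat (\<i> * \<delta>) z + s"
  have uw: "u \<in> carrier_mat n2 n2" "w \<in> carrier_mat n2 n2" "y * h \<in> carrier_mat n2 n2"
    "h * z \<in> carrier_mat n2 n2" "?I \<in> carrier_mat n2 n2"
    using y r z s h by (auto simp: u_def w_def)
  have rect: "X \<in> rect_mats" if "X \<in> carrier_mat n2 n2" for X :: "'a mat"
    using that pos by (auto simp: rect_mats_def)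
  have dims: "dim_row X = n2" "dim_col X = n2" if "X \<in> carrier_mat n2 n2" for X :: "'a mat"
    using that by auto
  have scaled: "p (scaleC_mat (\<i> * complex_of_real t) X) \<le> t * b"
    if "X \<in> carrier_mat n2 n2" "p X \<le> b" "0 \<le> t" for t b X
    using that rect by (simp add: scaleC norm_mult mult_left_mono)

  have "p u \<le> \<delta>\<^sup>2 * (2 / \<delta>\<^sup>2) + \<delta>\<^sup>2"
    unfolding u_def using y r rect dims \<delta> by (intro add_mono scaled) auto
  also have "\<dots> \<le> 3"
    using \<delta>2 \<delta> by simp
  finally have "p u \<le> 3" .
  then have yh_le: "p (y * h) \<le> 1 + 3"
    unfolding yh u_def[symmetric] using uw rect dims one_le[OF pos(4)] by (intro diff_mono) auto
  have "p w \<le> \<delta> * (2 / \<delta>) + \<delta>\<^sup>2"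
    unfolding w_def using z s rect dims \<delta> by (intro add_mono scaled) auto
  also have "\<dots> \<le> 3"
    using \<delta>2 \<delta> by simp
  finally have w_le: "p w \<le> 3" .
  then have hz_le: "p (h * z) \<le> 1 + 3"
    unfolding hz w_def[symmetric] using uw rect dims one_le[OF pos(4)] by (intro diff_mono) auto

  have sD: "star_mat D \<in> carrier_mat n2 m2"
    using D by auto
  \<comment> \<open>\<open>X * D\<close> equals \<open>E * (y * h)\<close>, so subtracting
    \<open>X\<close> times the second block row leaves the corner \<open>E * u\<close>.\<close>
  define X where "X = E * (y * star_mat D)"
  have X: "X \<in> carrier_mat m1 m2"
    using E D y by (auto simp: X_def)
  have XD: "X * D \<in> carrier_mat m1 n2"
    using X D by auto
  define F where "F = (E - X * D) * (h * z)"
  define G where "G = D * (h * z) - D"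
  have F: "F \<in> carrier_mat m1 n2"
    unfolding F_def by (rule mult_carrier_mat[OF minus_carrier_mat[OF XD] uw(4)])
  have G: "G \<in> carrier_mat m2 n2"
    unfolding G_def by (rule minus_carrier_mat[OF D])

  have u_eq: "?I - y * h = u"
    unfolding yh u_def[symmetric] by (rule eq_matI) (use uw in auto)
  have w_eq: "?I - h * z = w"
    unfolding hz w_def[symmetric] by (rule eq_matI) (use uw in auto)
  have "X * D = E * (y * h)"
    unfolding X_def h_def
    by (simp only: assoc_mult_mat[OF E mult_carrier_mat[OF y(1) sD] D] assoc_mult_mat[OF y(1) sD D])
  then have "E - X * D = E * (?I - y * h)"
    using mult_minus_distrib_mat[OF E uw(5,3)] E by simp
  then have "F = E * (u * (h * z))"
    unfolding F_def u_eq using assoc_mult_mat[OF E uw(1,4)] by simp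
  moreover have "p (u * (h * z)) \<le> (8 + 2 * H) * \<delta>"
  proof -
    \<comment> \<open>The regrouping is decisive: \<open>y * h\<close> is bounded and
      \<open>z\<close> costs only 2/\<delta>, so the scalar \<open>\<delta>\<^sup>2\<close> leaves
      order \<delta>. Estimating \<open>y\<close> separately from \<open>h * z\<close> would leave
      only a constant.\<close>
    have "y * (h * z) = (y * h) * z"
      using assoc_mult_mat[OF y(1) h z(1)] by simp
    moreover have "p ((y * h) * z) \<le> (1 + 3) * (2 / \<delta>)"
      using yh_le z uw rect dims by (intro mult_mono) auto
    ultimately have "p (y * (h * z)) \<le> (1 + 3) * (2 / \<delta>)"
      by simp
    then have 1: "p (scaleC_mat (\<i> * (\<delta>\<^sup>2)) (y * (h * z))) \<le> \<delta>\<^sup>2 * ((1 + 3) * (2 / \<delta>))"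
      using y uw by (intro scaled) auto
    have 2: "p (r * (h * z)) \<le> \<delta>\<^sup>2 * (H * (2 / \<delta>))"
      using r z h uw rect dims H by (intro mult_mono) auto
    have "u * (h * z) = scaleC_mat (\<i> * (\<delta>\<^sup>2)) (y * (h * z)) + r * (h * z)"
    proof -
      have "scaleC_mat (\<i> * (\<delta>\<^sup>2)) y * (h * z) = scaleC_mat (\<i> * (\<delta>\<^sup>2)) (y * (h * z))"
        by (rule scaleC_mat_mult_left) (simp only: dims[OF y(1)] dims[OF uw(4)])
      moreover have "scaleC_mat (\<i> * (\<delta>\<^sup>2)) y \<in> carrier_mat n2 n2"
        using y by simp
      ultimately show ?thesis
        unfolding u_def using add_mult_distrib_mat[OF _ r(1) uw(4)] by metis
    qed
    moreover have "p (scaleC_mat (\<i> * (\<delta>\<^sup>2)) (y * (h * z)) + r * (h * z)) \<le>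
        \<delta>\<^sup>2 * ((1 + 3) * (2 / \<delta>)) + \<delta>\<^sup>2 * (H * (2 / \<delta>))"
      using y r uw pos by (intro add_mono 1 2) (auto simp: rect_mats_def)
    moreover have "\<delta>\<^sup>2 * ((1 + 3) * (2 / \<delta>)) + \<delta>\<^sup>2 * (H * (2 / \<delta>)) = (8 + 2 * H) * \<delta>"
      using \<delta> by (simp add: power2_eq_square field_simps)
    ultimately show ?thesis
      by simp
  qed
  ultimately have F_le: "p F \<le> p E * ((8 + 2 * H) * \<delta>)"
    using E uw pos by (auto intro!: mult_mono simp: rect_mats_def)

  have Dw: "D * w = D - D * (h * z)"
    unfolding w_eq[symmetric] using mult_minus_distrib_mat[OF D uw(5,4)] D by simp
  \<comment> \<open>Up to sign \<open>G\<close> is \<open>D * w\<close>, whose square by the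
    C*-identity is the seminorm of \<open>star_mat w * (h * w)\<close>. Here \<open>w\<close> is
    merely bounded, but \<open>h * w\<close> is of order \<delta>, hence the square root.\<close>
  have "G = scaleC_mat (- 1) (D * w)"
    unfolding Dw G_def by (rule eq_matI) (use D uw in auto)
  then have "p G = p (D * w)"
    using D uw pos by (simp add: scaleC rect_mats_def)
  moreover have "(p (D * w))\<^sup>2 = p (star_mat (D * w) * (D * w))"
    using D uw pos by (intro cstar[symmetric]) (auto simp: rect_mats_def)
  moreover have "star_mat (D * w) * (D * w) = star_mat w * (h * w)"
  proof -
    have sw: "star_mat w \<in> carrier_mat n2 n2" "D * w \<in> carrier_mat m2 n2"
      using D uw by auto
    show ?thesis
      unfolding h_def assoc_mult_mat[OF sD D uw(2)] assoc_mult_mat[OF sw(1) sD sw(2), symmetric]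
      using D uw(2) by (subst star_mat_mult) auto
  qed
  moreover have "p (star_mat w * (h * w)) \<le> 3 * ((4 + H) * \<delta>)"
  proof (rule mult_mono)
    have "h * w = scaleC_mat (\<i> * \<delta>) (h * z) + h * s"
    proof -
      have "h * scaleC_mat (\<i> * \<delta>) z = scaleC_mat (\<i> * \<delta>) (h * z)"
        by (rule scaleC_mat_mult_right) (simp only: dims[OF h] dims[OF z(1)])
      moreover have "scaleC_mat (\<i> * \<delta>) z \<in> carrier_mat n2 n2"
        using z by simp
      ultimately show ?thesis
        unfolding w_def using mult_add_distrib_mat[OF h _ s(1)] by metis
    qed
    moreover have "p (scaleC_mat (\<i> * \<delta>) (h * z) + h * s) \<le> \<delta> * (1 + 3) + H * \<delta>\<^sup>2"
    proof (rule add_mono)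
      show "p (scaleC_mat (\<i> * \<delta>) (h * z)) \<le> \<delta> * (1 + 3)"
        by (rule scaled[OF uw(4) hz_le]) (use \<delta> in simp)
      show "p (h * s) \<le> H * \<delta>\<^sup>2"
        by (rule mult_mono[OF rect[OF h] rect[OF s(1)]])
          (simp_all only: dims[OF h] dims[OF s(1)] H(1) s(2) order_refl)
    qed (use h s z pos in \<open>auto simp: rect_mats_def\<close>)
    moreover have "\<delta> * (1 + 3) + H * \<delta>\<^sup>2 \<le> (4 + H) * \<delta>"
      using mult_left_mono[OF \<delta>2(2) H(2)] by (simp add: algebra_simps)
    ultimately show "p (h * w) \<le> (4 + H) * \<delta>"
      by simp
  qed (use w_le uw h pos in \<open>auto simp: rect_mats_def\<close>)
  ultimately have "(p G)\<^sup>2 \<le> 3 * ((4 + H) * \<delta>)"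
    by simp
  then have G_le: "p G \<le> sqrt (3 * ((4 + H) * \<delta>))"
    by (rule real_le_rsqrt)

  \<comment> \<open>\<open>L\<close> performs the row operation with \<open>X\<close>, and
    \<open>R\<close> multiplies the second block column by \<open>h * z\<close>.\<close>
  define L where "L = four_block_mat (1\<^sub>m m1) (- X) (0\<^sub>m m2 m1) (1\<^sub>m m2)"
  define R where "R = four_block_mat (1\<^sub>m n1) (0\<^sub>m n1 n2) (0\<^sub>m n2 n1) (h * z)"
  have "E + - (X * D) = E - X * D"
    by (rule eq_matI) (use E X D in auto)
  then have "L * upper_mat C E D = four_block_mat C (E - X * D) (0\<^sub>m m2 n1) D"
    using C E D X by (simp add: L_def upper_mat_def four_block_mat_mult_dims)
  then have "L * upper_mat C E D * R = four_block_mat C F (0\<^sub>m m2 n1) (D * (h * z))"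
    using C E D X uw(4) h z(1) by (simp add: R_def F_def four_block_mat_mult_dims)
  then have "L * upper_mat C E D * R - diag_mat2 C D =
      four_block_mat (0\<^sub>m m1 n1) F (0\<^sub>m m2 n1) G"
    using C F D uw by (intro eq_matI) (auto simp: diag_mat2_alt G_def)
  moreover have "p (four_block_mat (0\<^sub>m m1 n1) F (0\<^sub>m m2 n1) G) \<le>
      p (0\<^sub>m m1 n1) + p F + (p (0\<^sub>m m2 n1) + p G)"
    using F G pos by (intro four_block_le) (auto simp: rect_mats_def)
  ultimately have "p (L * upper_mat C E D * R - diag_mat2 C D) \<le>
      p E * ((8 + 2 * H) * \<delta>) + sqrt (3 * ((4 + H) * \<delta>))"
    using F_le G_le pos by simp
  moreover have "L \<in> carrier_mat (m1 + m2) (m1 + m2)" "R \<in> carrier_mat (n1 + n2) (n1 + n2)"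
    using X uw by (auto simp: L_def R_def)
  ultimately show ?thesis
    by blast
qed

end

subsection \<open>The Cuntz preorder\<close>

lemma bdd_above_cstar_seminorms:
  assumes "A \<in> rect_mats"
  shows "bdd_above ((\<lambda>p. p A) ` {p. mat_cstar_seminorm p})"
  using cstar_seminorm.le_sum_norm[OF cstar_seminorm.intro assms] by (intro bdd_aboveI2) auto

text \<open>The family is nonempty, as least upper bounds of reals require; comparison with this
  member also shows that the supremum is nonnegative.\<close>

lemma zero_cstar_seminorm: "mat_cstar_seminorm (\<lambda>_. 0)"
  by (simp add: mat_cstar_seminorm_def)

lemma le_cstar_mat_norm:
  "A \<in> rect_mats \<Longrightarrow> mat_cstar_seminorm p \<Longrightarrow> p A \<le> cstar_mat_norm A"
  unfolding cstar_mat_norm_def by (rule cSUP_upper) (auto intro: bdd_above_cstar_seminorms)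

lemma cstar_mat_norm_le:
  "(\<And>p. mat_cstar_seminorm p \<Longrightarrow> p A \<le> b) \<Longrightarrow> cstar_mat_norm A \<le> b"
  unfolding cstar_mat_norm_def using zero_cstar_seminorm by (intro cSUP_least) auto

lemma cstar_mat_norm_nonneg: "A \<in> rect_mats \<Longrightarrow> 0 \<le> cstar_mat_norm A"
  by (drule le_cstar_mat_norm[OF _ zero_cstar_seminorm])

text \<open>Upper bounds pass to the supremum directly. The two equalities, homogeneity and the
  C*-identity, need a separate argument for the reverse inequality.\<close>

lemma cstar_seminorm_cstar_mat_norm: "cstar_seminorm cstar_mat_norm"
proof (rule cstar_seminorm.intro, unfold mat_cstar_seminorm_def, intro conjI ballI allI impI)
  fix A B :: "'a mat"
  assume AB: "A \<in> rect_mats" "B \<in> rect_mats"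
  {
    assume dims: "dim_row A = dim_row B" "dim_col A = dim_col B"
    show "cstar_mat_norm (A + B) \<le> cstar_mat_norm A + cstar_mat_norm B"
    proof (rule cstar_mat_norm_le)
      fix p :: "'a mat \<Rightarrow> real" assume p: "mat_cstar_seminorm p"
      then show "p (A + B) \<le> cstar_mat_norm A + cstar_mat_norm B"
        using AB dims by (intro cstar_seminorm.add_mono cstar_seminorm.intro le_cstar_mat_norm)
    qed
  next
    assume dims: "dim_col A = dim_row B"
    show "cstar_mat_norm (A * B) \<le> cstar_mat_norm A * cstar_mat_norm B"
    proof (rule cstar_mat_norm_le)
      fix p :: "'a mat \<Rightarrow> real" assume p: "mat_cstar_seminorm p"
      then show "p (A * B) \<le> cstar_mat_norm A * cstar_mat_norm B"
        using AB dims by (intro cstar_seminorm.mult_mono cstar_seminorm.intro le_cstar_mat_norm)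
    qed
  }
next
  fix A :: "'a mat" assume A: "A \<in> rect_mats"
  then show "0 \<le> cstar_mat_norm A"
    by (rule cstar_mat_norm_nonneg)
  show "cstar_mat_norm (star_mat A * A) = (cstar_mat_norm A)\<^sup>2"
  proof (rule antisym)
    show "cstar_mat_norm (star_mat A * A) \<le> (cstar_mat_norm A)\<^sup>2"
    proof (rule cstar_mat_norm_le)
      fix p :: "'a mat \<Rightarrow> real" assume p: "mat_cstar_seminorm p"
      then interpret cstar_seminorm p by (rule cstar_seminorm.intro)
      show "p (star_mat A * A) \<le> (cstar_mat_norm A)\<^sup>2"
        using A by (simp add: cstar power_mono nonneg le_cstar_mat_norm[OF A p])
    qed
    have "star_mat A * A \<in> rect_mats"
      using A by (auto simp: rect_mats_def)
    \<comment> \<open>Taking square roots turns the reverse inequality into an upper bound for each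
      \<open>p A\<close>, which does pass to the supremum.\<close>
    have "cstar_mat_norm A \<le> sqrt (cstar_mat_norm (star_mat A * A))"
    proof (rule cstar_mat_norm_le)
      fix p :: "'a mat \<Rightarrow> real" assume p: "mat_cstar_seminorm p"
      then interpret cstar_seminorm p by (rule cstar_seminorm.intro)
      show "p A \<le> sqrt (cstar_mat_norm (star_mat A * A))"
        using le_cstar_mat_norm[OF \<open>star_mat A * A \<in> rect_mats\<close> p] A
        by (intro real_le_rsqrt) (simp add: cstar)
    qed
    then show "(cstar_mat_norm A)\<^sup>2 \<le> cstar_mat_norm (star_mat A * A)"
      using power_mono[of _ _ 2] cstar_mat_norm_nonneg[OF A]
        cstar_mat_norm_nonneg[OF \<open>star_mat A * A \<in> rect_mats\<close>]
      by (metis real_sqrt_pow2)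
  qed
  fix c
  \<comment> \<open>For nonzero \<open>c\<close> the reverse inequality follows by applying this one
    to the scalar \<open>1 / c\<close>.\<close>
  have le: "cstar_mat_norm (scaleC_mat c B) \<le> cmod c * cstar_mat_norm B" if "B \<in> rect_mats" for c and B :: "'a mat"
  proof (rule cstar_mat_norm_le)
    fix p :: "'a mat \<Rightarrow> real" assume p: "mat_cstar_seminorm p"
    then interpret cstar_seminorm p by (rule cstar_seminorm.intro)
    show "p (scaleC_mat c B) \<le> cmod c * cstar_mat_norm B"
      using that by (simp add: scaleC mult_left_mono le_cstar_mat_norm[OF that p])
  qed
  show "cstar_mat_norm (scaleC_mat c A) = cmod c * cstar_mat_norm A"
  proof (cases "c = 0")
    case True
    have "scaleC_mat c A \<in> rect_mats"
      using A by (simp add: rect_mats_def)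
    then show ?thesis
      using True le[OF A, of c] cstar_mat_norm_nonneg[of "scaleC_mat c A"] by simp
  next
    case False
    have "scaleC_mat (1 / c) (scaleC_mat c A) = A"
      by (rule eq_matI) (use False in \<open>auto simp: scaleC_scaleC\<close>)
    moreover have "scaleC_mat c A \<in> rect_mats"
      using A by (simp add: rect_mats_def)
    ultimately have "cstar_mat_norm A \<le> cmod (1 / c) * cstar_mat_norm (scaleC_mat c A)"
      using le[of "scaleC_mat c A" "1 / c"] by simp
    then have "cmod c * cstar_mat_norm A \<le> cstar_mat_norm (scaleC_mat c A)"
      using False by (simp add: norm_divide field_simps)
    then show ?thesis
      using le[OF A, of c] by simp
  qed
next
  fix a :: 'a
  show "cstar_mat_norm (mat 1 1 (\<lambda>_. a)) \<le> norm a"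
    by (rule cstar_mat_norm_le) (auto simp: mat_cstar_seminorm_def)
qed

interpretation cstar_norm: cstar_seminorm cstar_mat_norm
  by (rule cstar_seminorm_cstar_mat_norm)

section \<open>The Cuntz preorder on matrices\<close>

lemma cuntz_le_iff:
  "cuntz_le A B \<longleftrightarrow> A \<in> rect_mats \<and> B \<in> rect_mats \<and>
     (\<forall>e>0. \<exists>C\<in>carrier_mat (dim_row A) (dim_row B). \<exists>D\<in>carrier_mat (dim_col B) (dim_col A).
        cstar_mat_norm (C * B * D - A) < e)"
    (is "_ \<longleftrightarrow> _ \<and> _ \<and> ?approx")
proof -
  have nonneg: "0 \<le> cstar_mat_norm (C * B * D - A)" if "A \<in> rect_mats" for C D
    using that by (intro cstar_norm.nonneg) (auto simp: rect_mats_def)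
  have "?approx \<longleftrightarrow> (\<exists>C D. (\<forall>n. C n \<in> carrier_mat (dim_row A) (dim_row B) \<and>
      D n \<in> carrier_mat (dim_col B) (dim_col A)) \<and>
      (\<lambda>n. cstar_mat_norm (C n * B * D n - A)) \<longlonglongrightarrow> 0)" if A: "A \<in> rect_mats"
  proof
    assume ?approx
    \<comment> \<open>Tolerance 1/(n + 1) at stage \<open>n\<close>; the two factors are chosen
      together as a pair.\<close>
    then have "\<forall>n. \<exists>CD. fst CD \<in> carrier_mat (dim_row A) (dim_row B) \<and>
        snd CD \<in> carrier_mat (dim_col B) (dim_col A) \<and>
        cstar_mat_norm (fst CD * B * snd CD - A) < 1 / real (Suc n)"
      by (metis fst_conv snd_conv of_nat_0_less_iff zero_less_Suc zero_less_divide_1_iff)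
    then obtain f where f: "\<And>n. fst (f n) \<in> carrier_mat (dim_row A) (dim_row B)"
      "\<And>n. snd (f n) \<in> carrier_mat (dim_col B) (dim_col A)"
      "\<And>n. cstar_mat_norm (fst (f n) * B * snd (f n) - A) < 1 / real (Suc n)"
      by metis
    have "(\<lambda>n. cstar_mat_norm (fst (f n) * B * snd (f n) - A)) \<longlonglongrightarrow> 0"
      by (rule tendsto_sandwich[OF _ _ tendsto_const LIMSEQ_Suc[OF lim_1_over_n]])
        (use f(3) nonneg[OF A] in \<open>auto intro!: always_eventually less_imp_le\<close>)
    then show "\<exists>C D. (\<forall>n. C n \<in> carrier_mat (dim_row A) (dim_row B) \<and>
      D n \<in> carrier_mat (dim_col B) (dim_col A)) \<and>
      (\<lambda>n. cstar_mat_norm (C n * B * D n - A)) \<longlonglongrightarrow> 0"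
      using f(1,2) by (intro exI[of _ "\<lambda>n. fst (f n)"] exI[of _ "\<lambda>n. snd (f n)"]) auto
  next
    assume "\<exists>C D. (\<forall>n. C n \<in> carrier_mat (dim_row A) (dim_row B) \<and>
      D n \<in> carrier_mat (dim_col B) (dim_col A)) \<and>
      (\<lambda>n. cstar_mat_norm (C n * B * D n - A)) \<longlonglongrightarrow> 0"
    then obtain C D where CD: "\<And>n. C n \<in> carrier_mat (dim_row A) (dim_row B)"
      "\<And>n. D n \<in> carrier_mat (dim_col B) (dim_col A)"
      "(\<lambda>n. cstar_mat_norm (C n * B * D n - A)) \<longlonglongrightarrow> 0"
      by blast
    show ?approx
    proof (intro allI impI)
      fix e :: real assume "0 < e"
      from order_tendstoD(2)[OF CD(3) this] obtain n where "cstar_mat_norm (C n * B * D n - A) < e"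
        by (auto simp: eventually_sequentially)
      with CD(1,2) show "\<exists>C\<in>carrier_mat (dim_row A) (dim_row B).
          \<exists>D\<in>carrier_mat (dim_col B) (dim_col A). cstar_mat_norm (C * B * D - A) < e"
        by blast
    qed
  qed
  then show ?thesis
    unfolding cuntz_le_def by blast
qed

lemma mat_preorder_cuntz: "mat_preorder cuntz_le"
proof
  fix A B Z :: "'a mat"
  assume AB: "cuntz_le A B" and BZ: "cuntz_le B Z"
  have rect: "A \<in> rect_mats" "B \<in> rect_mats" "Z \<in> rect_mats"
    using AB BZ by (auto simp: cuntz_le_def)
  show "cuntz_le A Z"
    unfolding cuntz_le_iff
  proof (intro conjI rect allI impI)
    fix e :: real assume e: "0 < e"
    obtain C D where C: "C \<in> carrier_mat (dim_row A) (dim_row B)"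
      and D: "D \<in> carrier_mat (dim_col B) (dim_col A)"
      and CD: "cstar_mat_norm (C * B * D - A) < e / 2"
      using AB e unfolding cuntz_le_iff by (meson half_gt_zero)
    have CD_rect: "C \<in> rect_mats" "D \<in> rect_mats"
      using C D rect by (auto simp: rect_mats_def)
    \<comment> \<open>The factors \<open>C\<close> and \<open>D\<close> are fixed first, and
      \<open>B\<close> is then approximated with an error small compared to \<open>K\<close>; the
      summand 1 in \<open>K + 1\<close> keeps the denominator positive when \<open>K\<close> is
      0.\<close>
    define K where "K = cstar_mat_norm C * cstar_mat_norm D"
    have K: "0 \<le> K"
      using CD_rect by (simp add: K_def cstar_norm.nonneg)
    then have "0 < e / (2 * (K + 1))"
      using e by simp
    then obtain X Y where X: "X \<in> carrier_mat (dim_row B) (dim_row Z)"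
      and Y: "Y \<in> carrier_mat (dim_col Z) (dim_col B)"
      and XY: "cstar_mat_norm (X * Z * Y - B) < e / (2 * (K + 1))"
      using BZ unfolding cuntz_le_iff by blast
    have Z: "Z \<in> carrier_mat (dim_row Z) (dim_col Z)" and B: "B \<in> carrier_mat (dim_row B) (dim_col B)"
      by auto
    define W where "W = X * Z * Y"
    have W: "W \<in> carrier_mat (dim_row B) (dim_col B)"
      using X Y by (auto simp: W_def)
    note CW = mult_carrier_mat[OF C W] and CB = mult_carrier_mat[OF C B]
    note CWD = mult_carrier_mat[OF CW D] and CBD = mult_carrier_mat[OF CB D]
    have triangle: "U - A = (U - V) + (V - A)"
      if "U \<in> carrier_mat (dim_row A) (dim_col A)" "V \<in> carrier_mat (dim_row A) (dim_col A)" for U V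
      by (rule eq_matI) (use that in auto)
    have "C * X * Z * (Y * D) = C * W * D"
    proof -
      have XZ: "X * Z \<in> carrier_mat (dim_row B) (dim_col Z)" "C * X * Z \<in> carrier_mat (dim_row A) (dim_col Z)"
        using X C by auto
      show ?thesis
        unfolding W_def
        by (simp only: assoc_mult_mat[OF C X Z] assoc_mult_mat[OF C XZ(1) Y, symmetric]
            assoc_mult_mat[OF _ Y D, symmetric, OF XZ(2), unfolded assoc_mult_mat[OF C X Z]])
    qed
    then have "C * X * Z * (Y * D) - A = (C * W * D - C * B * D) + (C * B * D - A)"
      using triangle[OF CWD CBD] by (simp only:)
    also have "C * W * D - C * B * D = C * (W - B) * D"
      by (simp only: mult_minus_distrib_mat[OF C W B] minus_mult_distrib_mat[OF CW CB D])
    finally have eq: "C * X * Z * (Y * D) - A = C * (W - B) * D + (C * B * D - A)" .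
    have "cstar_mat_norm (C * (W - B) * D + (C * B * D - A)) \<le>
        cstar_mat_norm C * (e / (2 * (K + 1))) * cstar_mat_norm D + e / 2"
    proof (intro cstar_norm.add_mono cstar_norm.mult_mono order_refl)
      show "cstar_mat_norm (W - B) \<le> e / (2 * (K + 1))" "cstar_mat_norm (C * B * D - A) \<le> e / 2"
        using XY CD by (simp_all add: W_def)
    qed (use C D rect CD_rect in \<open>simp_all add: rect_mats_def\<close>)
    moreover have "cstar_mat_norm C * (e / (2 * (K + 1))) * cstar_mat_norm D < e / 2"
    proof -
      have "cstar_mat_norm C * (e / (2 * (K + 1))) * cstar_mat_norm D = K * e / (2 * (K + 1))"
        by (simp add: K_def)
      also have "\<dots> < e / 2"
        using K e by (simp add: field_simps)
      finally show ?thesis .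
    qed
    ultimately have "cstar_mat_norm (C * X * Z * (Y * D) - A) < e"
      unfolding eq by linarith
    moreover have "C * X \<in> carrier_mat (dim_row A) (dim_row Z)" "Y * D \<in> carrier_mat (dim_col Z) (dim_col A)"
      using C D X Y by auto
    ultimately show "\<exists>C\<in>carrier_mat (dim_row A) (dim_row Z). \<exists>D\<in>carrier_mat (dim_col Z) (dim_col A).
        cstar_mat_norm (C * Z * D - A) < e"
      by blast
  qed
next
  fix B C D :: "'a mat" and m n :: nat
  assume *: "B \<in> rect_mats" "0 < m" "0 < n" "C \<in> carrier_mat m (dim_row B)"
    "D \<in> carrier_mat (dim_col B) n"
  then have "C * B * D - C * B * D = 0\<^sub>m m n"
    by (intro eq_matI) auto
  then have "cstar_mat_norm (C * B * D - C * B * D) = 0"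
    using * by simp
  moreover have "C \<in> carrier_mat (dim_row (C * B * D)) (dim_row B)"
    "D \<in> carrier_mat (dim_col B) (dim_col (C * B * D))" "C * B * D \<in> rect_mats"
    using * by (auto simp: rect_mats_def)
  ultimately show "cuntz_le (C * B * D) B"
    unfolding cuntz_le_iff using *(1) by metis
next
  fix A B X :: "'a mat"
  assume AB: "cuntz_le A B" and X: "X \<in> rect_mats"
  have rect: "A \<in> rect_mats" "B \<in> rect_mats"
    using AB by (auto simp: cuntz_le_def)
  show "cuntz_le (diag_mat2 A X) (diag_mat2 B X)"
    unfolding cuntz_le_iff
  proof (intro conjI allI impI)
    fix e :: real assume "0 < e"
    then obtain C D where C: "C \<in> carrier_mat (dim_row A) (dim_row B)"
      and D: "D \<in> carrier_mat (dim_col B) (dim_col A)"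
      and CD: "cstar_mat_norm (C * B * D - A) < e"
      using AB unfolding cuntz_le_iff by blast
    let ?C = "diag_mat2 C (1\<^sub>m (dim_row X))" and ?D = "diag_mat2 D (1\<^sub>m (dim_col X))"
    have "?C * diag_mat2 B X * ?D = diag_mat2 (C * B * D) X"
      using C D by (simp add: diag_mat2_mult)
    \<comment> \<open>The identity blocks reproduce \<open>X\<close> exactly, so the only error is
      that of approximating \<open>A\<close>.\<close>
    moreover have "diag_mat2 (C * B * D) X - diag_mat2 A X =
        diag_mat2 (C * B * D - A) (0\<^sub>m (dim_row X) (dim_col X))"
      by (rule eq_matI) (use C D in \<open>auto simp: diag_mat2_alt\<close>)
    moreover have "cstar_mat_norm (diag_mat2 (C * B * D - A) (0\<^sub>m (dim_row X) (dim_col X))) < e"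
      using cstar_norm.diag_mat2_le[of "C * B * D - A" "0\<^sub>m (dim_row X) (dim_col X)"] CD C D rect X
      by (auto simp: rect_mats_def)
    moreover have "?C \<in> carrier_mat (dim_row (diag_mat2 A X)) (dim_row (diag_mat2 B X))"
      "?D \<in> carrier_mat (dim_col (diag_mat2 B X)) (dim_col (diag_mat2 A X))"
      using C D by auto
    ultimately show "\<exists>C\<in>carrier_mat (dim_row (diag_mat2 A X)) (dim_row (diag_mat2 B X)).
        \<exists>D\<in>carrier_mat (dim_col (diag_mat2 B X)) (dim_col (diag_mat2 A X)).
          cstar_mat_norm (C * diag_mat2 B X * D - diag_mat2 A X) < e"
      by metis
  qed (use rect in \<open>auto simp: diag_mat2_rect\<close>)
qed (auto simp: cuntz_le_def)

interpretation cuntz: mat_preorder cuntz_le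
  by (rule mat_preorder_cuntz)

section \<open>From the Malcolmson preorder to the Cuntz preorder\<close>

lemma cuntz_le_upper_mat:
  assumes "C \<in> rect_mats" "D \<in> rect_mats" "E \<in> rect_mats"
    "dim_row E = dim_row C" "dim_col E = dim_col D"
  shows "cuntz_le (diag_mat2 C D) (upper_mat C E D)"
  unfolding cuntz_le_iff
proof (intro conjI allI impI)
  fix e :: real assume "0 < e"
  define H where "H = cstar_mat_norm (star_mat D * D)"
  let ?err = "\<lambda>\<delta>. cstar_mat_norm E * ((8 + 2 * H) * \<delta>) + sqrt (3 * ((4 + H) * \<delta>))"
  \<comment> \<open>\<open>?err\<close> is continuous in \<delta> and vanishes at 0, so some
    \<delta> between 0 and 1 makes it smaller than \<open>e\<close>.\<close>
  have "(?err \<longlongrightarrow> cstar_mat_norm E * ((8 + 2 * H) * 0) + sqrt (3 * ((4 + H) * 0))) (at_right 0)"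
    by (intro tendsto_intros)
  then have "eventually (\<lambda>\<delta>. ?err \<delta> < e) (at_right 0)"
    using \<open>0 < e\<close> by (intro order_tendstoD) auto
  moreover have "eventually (\<lambda>\<delta>. \<delta> \<in> {0<..<1}) (at_right (0::real))"
    by (rule eventually_at_right_real) simp
  ultimately have "eventually (\<lambda>\<delta>. ?err \<delta> < e \<and> \<delta> \<in> {0<..<1}) (at_right 0)"
    by eventually_elim simp
  then obtain \<delta> where \<delta>: "?err \<delta> < e" "0 < \<delta>" "\<delta> < 1"
    using eventually_happens[of _ "at_right (0::real)"] by fastforce
  have carr: "C \<in> carrier_mat (dim_row C) (dim_col C)" "E \<in> carrier_mat (dim_row C) (dim_col D)"
    "D \<in> carrier_mat (dim_row D) (dim_col D)"
    using assms(4,5) by auto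
  have pos: "0 < dim_row C" "0 < dim_row D" "0 < dim_col C" "0 < dim_col D"
    using assms(1,2) by (auto simp: rect_mats_def)
  obtain L R where "L \<in> carrier_mat (dim_row C + dim_row D) (dim_row C + dim_row D)"
    "R \<in> carrier_mat (dim_col C + dim_col D) (dim_col C + dim_col D)"
    "cstar_mat_norm (L * upper_mat C E D * R - diag_mat2 C D) \<le> ?err \<delta>"
    using cstar_norm.upper_mat_error[OF carr pos \<delta>(2) less_imp_le[OF \<delta>(3)]]
    unfolding H_def by blast
  with \<delta>(1) show "\<exists>L\<in>carrier_mat (dim_row (diag_mat2 C D)) (dim_row (upper_mat C E D)).
      \<exists>R\<in>carrier_mat (dim_col (upper_mat C E D)) (dim_col (diag_mat2 C D)).
        cstar_mat_norm (L * upper_mat C E D * R - diag_mat2 C D) < e"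
    by (intro bexI[of _ L] bexI[of _ R]) simp_all
qed (use assms in \<open>auto simp: diag_mat2_rect upper_mat_rect\<close>)

text \<open>Steps by multiplication are exact instances of the Cuntz relation, triangular steps are
  the previous lemma, and transitivity handles chains.\<close>

lemma malcolmson_le_imp_cuntz_le:
  assumes "malcolmson_le A B"
  shows "cuntz_le A B"
proof -
  have step: "cuntz_le X Y" if "malcolmson_step X Y" for X Y :: "'a mat"
  proof -
    have rect: "X \<in> rect_mats" "Y \<in> rect_mats"
      using that by (auto simp: malcolmson_step_def)
    from that consider (mult) C D where "C \<in> rect_mats" "D \<in> rect_mats"
      "dim_col C = dim_row Y" "dim_row D = dim_col Y" "X = C * Y * D"
      | (upper) C D E where "C \<in> rect_mats" "D \<in> rect_mats" "E \<in> rect_mats"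
        "dim_row E = dim_row C" "dim_col E = dim_col D" "Y = upper_mat C E D" "X = diag_mat2 C D"
      unfolding malcolmson_step_def by blast
    then show ?thesis
    proof cases
      case mult
      have "C \<in> carrier_mat (dim_row C) (dim_row Y)" "D \<in> carrier_mat (dim_col Y) (dim_col D)"
        using mult(3,4) by auto
      moreover have "0 < dim_row C" "0 < dim_col D"
        using mult(1,2) by (auto simp: rect_mats_def)
      ultimately show ?thesis
        unfolding mult(5) by (intro cuntz.leq_mult[OF rect(2)])
    next
      case upper
      show ?thesis
        unfolding upper(6,7) by (rule cuntz_le_upper_mat[OF upper(1-5)])
    qed
  qed
  have "malcolmson_step\<^sup>*\<^sup>* A B" "A \<in> rect_mats"
    using assms by (auto simp: malcolmson_le_def)
  then show ?thesis
    by (induction rule: rtranclp_induct) (auto intro: cuntz.leq_refl cuntz.leq_trans step)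
qed

section \<open>Dimension functions are Sylvester rank functions\<close>

lemma dimension_function_sylvester:
  fixes \<phi> :: "'a::unital_cstar_algebra mat \<Rightarrow> real"
  assumes "dimension_function \<phi>"
  shows "sylvester_rank_function \<phi>"
proof -
  have nonneg: "0 \<le> \<phi> A" if "A \<in> rect_mats" for A
    using that assms by (auto simp: dimension_function_def)
  have mono: "\<phi> A \<le> \<phi> B" if "cuntz_le A B" for A B
    using that assms cuntz.leq_rect[OF that] by (auto simp: dimension_function_def)
  have one: "\<phi> (1\<^sub>m 1) = 1"
    using assms by (auto simp: dimension_function_def)
  have diag: "\<phi> (diag_mat2 A B) = \<phi> A + \<phi> B" if "A \<in> rect_mats" "B \<in> rect_mats" for A B
    using that assms by (auto simp: dimension_function_def)
  have zero: "\<phi> (0\<^sub>m m n) = 0" if "0 < m" "0 < n" for m n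
  proof -
    have rect: "(0\<^sub>m m n :: 'a mat) \<in> rect_mats" "(1\<^sub>m 1 :: 'a mat) \<in> rect_mats"
      using that by (auto simp: rect_mats_def)
    \<comment> \<open>\<open>diag_mat2 (0\<^sub>m m n) (1\<^sub>m 1)\<close> lies below
      \<open>1\<^sub>m 1\<close>, so additivity forces the value at the zero matrix to be at most
      0.\<close>
    show ?thesis
      using mono[OF cuntz.leq_diag_zero[OF rect(2), of m n]] nonneg[OF rect(1)] diag[OF rect] by simp
  qed
  have mult: "\<phi> (A * B) \<le> min (\<phi> A) (\<phi> B)"
    if "A \<in> rect_mats" "B \<in> rect_mats" "dim_col A = dim_row B" for A B
  proof -
    have pos: "0 < dim_row A" "0 < dim_col B"
      using that(1,2) by (auto simp: rect_mats_def)
    have A: "A \<in> carrier_mat (dim_row A) (dim_row B)"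
      and B: "B \<in> carrier_mat (dim_col A) (dim_col B)"
      using that(3) by auto
    \<comment> \<open>An identity on the free side puts the product in the three-factor form of
      \<open>leq_mult\<close>, once around \<open>A\<close> and once around
      \<open>B\<close>.\<close>
    have "cuntz_le (1\<^sub>m (dim_row A) * A * B) A"
      by (rule cuntz.leq_mult[OF that(1) pos one_carrier_mat B])
    moreover have "cuntz_le (A * B * 1\<^sub>m (dim_col B)) B"
      by (rule cuntz.leq_mult[OF that(2) pos A one_carrier_mat])
    moreover have "1\<^sub>m (dim_row A) * A = A"
      by (rule left_mult_one_mat'[OF refl])
    moreover have "A * B * 1\<^sub>m (dim_col B) = A * B"
      by (rule right_mult_one_mat'[OF index_mult_mat(3)])
    ultimately show ?thesis
      using mono by simp
  qed
  have upper: "\<phi> A + \<phi> B \<le> \<phi> (upper_mat A C B)"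
    if "A \<in> rect_mats" "B \<in> rect_mats" "C \<in> rect_mats" "dim_row C = dim_row A" "dim_col C = dim_col B"
    for A B C
    using mono[OF cuntz_le_upper_mat[OF that]] diag that by simp
  show ?thesis
    unfolding sylvester_rank_function_def
    by (intro conjI ballI allI impI; rule nonneg zero one mult diag upper; assumption)
qed

theorem proposition5p2:
  shows "(\<exists>h :: 'a::unital_cstar_algebra mat set \<Rightarrow> 'a mat set.
            (\<forall>A\<in>rect_mats. h (mat_class malcolmson_le A) = mat_class cuntz_le A) \<and>
            order_preserving_monoid_hom W_M W_M_order W_C W_C_order h) \<and>
         (\<forall>\<phi> :: 'a mat \<Rightarrow> real. dimension_function \<phi> \<longrightarrow> sylvester_rank_function \<phi>)"
  unfolding W_M_def W_M_order_def W_C_def W_C_order_def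
  by (intro conjI allI impI mat_class_hom mat_preorder_malcolmson mat_preorder_cuntz
      malcolmson_le_imp_cuntz_le dimension_function_sylvester)

end
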